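(* For every signature $\Sigma$ and every variety $\mathcal{V}$ of $\Sigma$-algebras, the forgetful functor $U\colon\mathcal{V}\to\mathsf{Pos}$ is monadic.
   Context: $\mathsf{Pos}$ is the category of posets and monotone maps. $\mathsf{Pos}_{\mathsf f}$ is a fixed representative set of all finite posets up to isomorphism; its members are called contexts. For posets $X,Y$, $\mathsf{Pos}_0(X,Y)$ is the set of monotone maps $X\to Y$. $|X|$ denotes the underlying set of a poset $X$. A signature $\Sigma$ is a family of sets $(\Sigma_\Gamma)_{\Gamma\in\mathsf{Pos}_{\mathsf f}}$; elements $\sigma\in\Sigma_\Gamma$ are operation symbols of arity $\Gamma$. A $\Sigma$-algebra is a poset $A$ with a function $\sigma_A\colon\mathsf{Pos}_0(\Gamma,A)\to A$ (not required to be monotone) for every $\Gamma\in\mathsf{Pos}_{\mathsf f}$ and $\sigma\in\Sigma_\Gamma$. A homomorphism $h\colon A\to B$ is a monotone map with $h(\sigma_A(f))=\sigma_B(h\cdot f)$ for all $\sigma\in\Sigma_\Gamma$, $f\in\mathsf{Pos}_0(\Gamma,A)$. These form the category $\mathsf{Alg}\,\Sigma$. For a context $\Gamma$, the set $\mathscr{T}(\Gamma)$ of terms is the least set containing $|\Gamma|$ such that for every $\sigma\in\Sigma_\Delta$ and every function $g\colon|\Delta|\to\mathscr{T}(\Gamma)$ there is a term $\sigma(g)\in\mathscr{T}(\Gamma)$ (terms are formed freely, ignoring the order of arities). Given a $\Sigma$-algebra $A$ and a monotone $f\colon\Gamma\to A$, the evaluation is the partial map $f^{\#}\colon\mathscr{T}(\Gamma)\to|A|$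 defined recursively: $f^{\#}(x)=f(x)$ for $x\in|\Gamma|$; for $\sigma\in\Sigma_\Delta$ and $g\colon|\Delta|\to\mathscr{T}(\Gamma)$, $f^{\#}(\sigma(g))$ is defined iff all $f^{\#}(g(i))$, $i\in|\Delta|$, are defined and $i\le j$ in $\Delta$ implies $f^{\#}(g(i))\le f^{\#}(g(j))$ in $A$, and then $f^{\#}(\sigma(g))=\sigma_A(f^{\#}\cdot g)$. An inequation in context $\Gamma\vdash s\le t$ is a pair $s,t\in\mathscr{T}(\Gamma)$; $A$ satisfies it if for every monotone $f\colon\Gamma\to A$ both $f^{\#}(s)$ and $f^{\#}(t)$ are defined and $f^{\#}(s)\le f^{\#}(t)$. A variety of $\Sigma$-algebras is the full subcategory of $\mathsf{Alg}\,\Sigma$ of all algebras satisfying a given set of inequations in context. *)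

theory Defs
  imports Main "HOL-Library.FuncSet" "HOL-Library.Equipollence"
begin

section \<open>Categories, adjunctions and monadic functors\<close>

text \<open>
  Hom-sets need not be disjoint; therefore composition and the arrow part of a functor take the
  objects involved as arguments: \<open>Comp C X Y Z g f\<close> is \<open>g \<circ> f\<close> for
  \<open>f : X \<rightarrow> Y\<close> and \<open>g : Y \<rightarrow> Z\<close>.
\<close>

record ('o, 'm) category =
  Obj :: "'o set"
  Hom :: "'o \<Rightarrow> 'o \<Rightarrow> 'm set"
  Id :: "'o \<Rightarrow> 'm"
  Comp :: "'o \<Rightarrow> 'o \<Rightarrow> 'o \<Rightarrow> 'm \<Rightarrow> 'm \<Rightarrow> 'm"

definition is_category :: "('o, 'm) category \<Rightarrow> bool" where
  "is_category C \<longleftrightarrow>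
     (\<forall>X\<in>Obj C. Id C X \<in> Hom C X X) \<and>
     (\<forall>X\<in>Obj C. \<forall>Y\<in>Obj C. \<forall>Z\<in>Obj C. \<forall>f\<in>Hom C X Y. \<forall>g\<in>Hom C Y Z.
        Comp C X Y Z g f \<in> Hom C X Z) \<and>
     (\<forall>X\<in>Obj C. \<forall>Y\<in>Obj C. \<forall>f\<in>Hom C X Y.
        Comp C X X Y f (Id C X) = f \<and> Comp C X Y Y (Id C Y) f = f) \<and>
     (\<forall>W\<in>Obj C. \<forall>X\<in>Obj C. \<forall>Y\<in>Obj C. \<forall>Z\<in>Obj C.
        \<forall>f\<in>Hom C W X. \<forall>g\<in>Hom C X Y. \<forall>h\<in>Hom C Y Z.
        Comp C W X Z (Comp C X Y Z h g) f = Comp C W Y Z h (Comp C W X Y g f))"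

definition full_subcategory ::
    "('o, 'm) category \<Rightarrow> ('o \<Rightarrow> bool) \<Rightarrow> ('o, 'm) category" where
  "full_subcategory C P = C\<lparr>Obj := {X \<in> Obj C. P X}\<rparr>"

record ('o, 'm, 'p, 'n) ftor =
  on_obj :: "'o \<Rightarrow> 'p"
  on_hom :: "'o \<Rightarrow> 'o \<Rightarrow> 'm \<Rightarrow> 'n"

definition is_functor ::
    "('o, 'm) category \<Rightarrow> ('p, 'n) category \<Rightarrow> ('o, 'm, 'p, 'n) ftor \<Rightarrow> bool" where
  "is_functor C D F \<longleftrightarrow>
     is_category C \<and> is_category D \<and>
     (\<forall>X\<in>Obj C. on_obj F X \<in> Obj D) \<and>
     (\<forall>X\<in>Obj C. \<forall>Y\<in>Obj C. \<forall>f\<in>Hom C X Y.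
        on_hom F X Y f \<in> Hom D (on_obj F X) (on_obj F Y)) \<and>
     (\<forall>X\<in>Obj C. on_hom F X X (Id C X) = Id D (on_obj F X)) \<and>
     (\<forall>X\<in>Obj C. \<forall>Y\<in>Obj C. \<forall>Z\<in>Obj C. \<forall>f\<in>Hom C X Y. \<forall>g\<in>Hom C Y Z.
        on_hom F X Z (Comp C X Y Z g f) =
        Comp D (on_obj F X) (on_obj F Y) (on_obj F Z) (on_hom F Y Z g) (on_hom F X Y f))"

definition id_ftor :: "('o, 'm, 'o, 'm) ftor" where
  "id_ftor = \<lparr>on_obj = \<lambda>X. X, on_hom = \<lambda>X Y f. f\<rparr>"

definition comp_ftor ::
    "('p, 'n, 'q, 'k) ftor \<Rightarrow> ('o, 'm, 'p, 'n) ftor \<Rightarrow> ('o, 'm, 'q, 'k) ftor" where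
  "comp_ftor G F =
     \<lparr>on_obj = \<lambda>X. on_obj G (on_obj F X),
      on_hom = \<lambda>X Y f. on_hom G (on_obj F X) (on_obj F Y) (on_hom F X Y f)\<rparr>"

text \<open>Equality of functors on \<open>C\<close>; junk values outside \<open>C\<close> are ignored.\<close>

definition eq_ftor ::
    "('o, 'm) category \<Rightarrow> ('o, 'm, 'p, 'n) ftor \<Rightarrow> ('o, 'm, 'p, 'n) ftor \<Rightarrow> bool" where
  "eq_ftor C F G \<longleftrightarrow>
     (\<forall>X\<in>Obj C. on_obj F X = on_obj G X) \<and>
     (\<forall>X\<in>Obj C. \<forall>Y\<in>Obj C. \<forall>f\<in>Hom C X Y. on_hom F X Y f = on_hom G X Y f)"

definition is_isomorphism ::
    "('o, 'm) category \<Rightarrow> ('p, 'n) category \<Rightarrow> ('o, 'm, 'p, 'n) ftor \<Rightarrow> bool" where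
  "is_isomorphism C D K \<longleftrightarrow>
     is_functor C D K \<and>
     (\<exists>L. is_functor D C L \<and> eq_ftor C (comp_ftor L K) id_ftor \<and> eq_ftor D (comp_ftor K L) id_ftor)"

definition nat_trans ::
    "('o, 'm) category \<Rightarrow> ('p, 'n) category \<Rightarrow> ('o, 'm, 'p, 'n) ftor \<Rightarrow> ('o, 'm, 'p, 'n) ftor
     \<Rightarrow> ('o \<Rightarrow> 'n) \<Rightarrow> bool" where
  "nat_trans C D F G \<alpha> \<longleftrightarrow>
     is_functor C D F \<and> is_functor C D G \<and>
     (\<forall>X\<in>Obj C. \<alpha> X \<in> Hom D (on_obj F X) (on_obj G X)) \<and>
     (\<forall>X\<in>Obj C. \<forall>Y\<in>Obj C. \<forall>f\<in>Hom C X Y.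
        Comp D (on_obj F X) (on_obj F Y) (on_obj G Y) (\<alpha> Y) (on_hom F X Y f) =
        Comp D (on_obj F X) (on_obj G X) (on_obj G Y) (on_hom G X Y f) (\<alpha> X))"

text \<open>\<open>F : C \<rightarrow> D\<close> is left adjoint to \<open>G : D \<rightarrow> C\<close> with unit \<open>\<eta>\<close> and counit \<open>\<epsilon>\<close>.\<close>

definition adjunction ::
    "('o, 'm) category \<Rightarrow> ('p, 'n) category \<Rightarrow> ('o, 'm, 'p, 'n) ftor \<Rightarrow> ('p, 'n, 'o, 'm) ftor
     \<Rightarrow> ('o \<Rightarrow> 'm) \<Rightarrow> ('p \<Rightarrow> 'n) \<Rightarrow> bool" where
  "adjunction C D F G \<eta> \<epsilon> \<longleftrightarrow>
     is_functor C D F \<and> is_functor D C G \<and>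
     nat_trans C C id_ftor (comp_ftor G F) \<eta> \<and>
     nat_trans D D (comp_ftor F G) id_ftor \<epsilon> \<and>
     (\<forall>X\<in>Obj C.
        let FX = on_obj F X; GFX = on_obj G FX; FGFX = on_obj F GFX
        in Comp D FX FGFX FX (\<epsilon> FX) (on_hom F X GFX (\<eta> X)) = Id D FX) \<and>
     (\<forall>Y\<in>Obj D.
        let GY = on_obj G Y; FGY = on_obj F GY; GFGY = on_obj G FGY
        in Comp C GY GFGY GY (on_hom G FGY Y (\<epsilon> Y)) (\<eta> GY) = Id C GY)"

text \<open>The Eilenberg--Moore category of the monad \<open>(T, \<eta>, \<mu>)\<close> on \<open>C\<close>.\<close>

definition EM_category ::
    "('o, 'm) category \<Rightarrow> ('o, 'm, 'o, 'm) ftor \<Rightarrow> ('o \<Rightarrow> 'm) \<Rightarrow> ('o \<Rightarrow> 'm)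
     \<Rightarrow> ('o \<times> 'm, 'm) category" where
  "EM_category C T \<eta> \<mu> =
     \<lparr>Obj = {(X, a). X \<in> Obj C \<and> a \<in> Hom C (on_obj T X) X \<and>
               Comp C X (on_obj T X) X a (\<eta> X) = Id C X \<and>
               Comp C (on_obj T (on_obj T X)) (on_obj T X) X a (on_hom T (on_obj T X) X a) =
               Comp C (on_obj T (on_obj T X)) (on_obj T X) X a (\<mu> X)},
      Hom = \<lambda>(X, a) (Y, b). {h \<in> Hom C X Y.
               Comp C (on_obj T X) X Y h a =
               Comp C (on_obj T X) (on_obj T Y) Y b (on_hom T X Y h)},
      Id = \<lambda>(X, a). Id C X,
      Comp = \<lambda>(X, a) (Y, b) (Z, c) g f. Comp C X Y Z g f\<rparr>"

text \<open>The monad \<open>(G F, \<eta>, G \<epsilon> F)\<close> of an adjunction, and the comparison functor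
  \<open>Y \<mapsto> (G Y, G \<epsilon>\<^sub>Y)\<close>, \<open>h \<mapsto> G h\<close>.\<close>

definition adj_mult ::
    "('o, 'm, 'p, 'n) ftor \<Rightarrow> ('p, 'n, 'o, 'm) ftor \<Rightarrow> ('p \<Rightarrow> 'n) \<Rightarrow> 'o \<Rightarrow> 'm" where
  "adj_mult F G \<epsilon> X = on_hom G (on_obj F (on_obj G (on_obj F X))) (on_obj F X) (\<epsilon> (on_obj F X))"

definition comparison ::
    "('o, 'm, 'p, 'n) ftor \<Rightarrow> ('p, 'n, 'o, 'm) ftor \<Rightarrow> ('p \<Rightarrow> 'n)
     \<Rightarrow> ('p, 'n, 'o \<times> 'm, 'm) ftor" where
  "comparison F G \<epsilon> =
     \<lparr>on_obj = \<lambda>Y. (on_obj G Y, on_hom G (on_obj F (on_obj G Y)) Y (\<epsilon> Y)),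
      on_hom = on_hom G\<rparr>"

text \<open>Monadicity in Mac Lane's sense: the comparison functor is an isomorphism (hence in
  particular an equivalence) of categories.\<close>

definition monadic ::
    "('p, 'n) category \<Rightarrow> ('o, 'm) category \<Rightarrow> ('p, 'n, 'o, 'm) ftor \<Rightarrow> bool" where
  "monadic D C G \<longleftrightarrow>
     (\<exists>F \<eta> \<epsilon>. adjunction C D F G \<eta> \<epsilon> \<and>
        is_isomorphism D (EM_category C (comp_ftor G F) \<eta> (adj_mult F G \<epsilon>)) (comparison F G \<epsilon>))"


section \<open>Universes\<close>

text \<open>
  HOL has no category of all posets, so \<open>Pos\<close> is formed relative to a universe \<open>U\<close> of small
  subsets of a type. The axioms are those of a Grothendieck universe containing an infinite set,
  without closure under power sets (which is not needed, and with which HOL could not prove that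
  universes exist). Every infinite type \<open>'u\<close> has the universe \<open>UNIV :: 'u set set\<close>; if \<open>'u\<close> has
  at least inaccessible cardinality \<open>\<kappa>\<close>, the subsets of \<open>'u\<close> with fewer than \<open>\<kappa>\<close> elements are
  the small sets in the usual sense.
\<close>

definition universe :: "'u set set \<Rightarrow> bool" where
  "universe U \<longleftrightarrow>
     (\<exists>A\<in>U. infinite A) \<and>
     (\<forall>A\<in>U. \<forall>B. B \<lesssim> A \<longrightarrow> B \<in> U) \<and>
     (\<forall>I\<in>U. \<forall>A. A ` I \<subseteq> U \<longrightarrow> \<Union> (A ` I) \<in> U)"

definition small :: "'u set set \<Rightarrow> 's set \<Rightarrow> bool" where
  "small U S \<longleftrightarrow> (\<exists>A\<in>U. S \<lesssim> A)"


section \<open>Posets\<close>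

text \<open>
  A poset is given by its order relation \<open>P\<close> with \<open>Partial_order P\<close>; since \<open>P\<close> is reflexive, the
  underlying set is \<open>Field P\<close>. Maps are extensional, i.e. \<open>undefined\<close> outside the domain, so that
  equality of maps is equality in HOL.
\<close>

definition monotone_maps :: "'a rel \<Rightarrow> 'b rel \<Rightarrow> ('a \<Rightarrow> 'b) set" where
  "monotone_maps P Q =
     {f \<in> Field P \<rightarrow>\<^sub>E Field Q. monotone_on (Field P) (\<lambda>x y. (x, y) \<in> P) (\<lambda>x y. (x, y) \<in> Q) f}"

definition Pos :: "'u set set \<Rightarrow> ('u rel, 'u \<Rightarrow> 'u) category" where
  "Pos U =
     \<lparr>Obj = {P. Partial_order P \<and> Field P \<in> U},
      Hom = monotone_maps,
      Id = \<lambda>P. \<lambda>x\<in>Field P. x,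
      Comp = \<lambda>P Q R g f. compose (Field P) g f\<rparr>"

definition poset_iso :: "'a rel \<Rightarrow> 'b rel \<Rightarrow> bool" where
  "poset_iso P Q \<longleftrightarrow>
     (\<exists>f. bij_betw f (Field P) (Field Q) \<and>
          (\<forall>x\<in>Field P. \<forall>y\<in>Field P. (x, y) \<in> P \<longleftrightarrow> (f x, f y) \<in> Q))"

text \<open>\<open>Ctx\<close> is a representative set of all finite posets up to isomorphism. Every finite poset
  is isomorphic to one on natural numbers, so it suffices to let the latter be represented.\<close>

definition represents_finite_posets :: "'v rel set \<Rightarrow> bool" where
  "represents_finite_posets Ctx \<longleftrightarrow>
     (\<forall>\<Gamma>\<in>Ctx. Partial_order \<Gamma> \<and> finite (Field \<Gamma>)) \<and>
     (\<forall>P :: nat rel. Partial_order P \<and> finite (Field P) \<longrightarrow> (\<exists>!\<Gamma>. \<Gamma> \<in> Ctx \<and> poset_iso P \<Gamma>))"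


section \<open>Algebras\<close>

text \<open>A signature is a family \<open>\<Sigma> :: 'v rel \<Rightarrow> 's set\<close>, of which only the members indexed by
  contexts matter.\<close>

definition signature :: "'u set set \<Rightarrow> 'v rel set \<Rightarrow> ('v rel \<Rightarrow> 's set) \<Rightarrow> bool" where
  "signature U Ctx \<Sigma> \<longleftrightarrow> (\<forall>\<Gamma>\<in>Ctx. small U (\<Sigma> \<Gamma>))"

record ('v, 's, 'a) alg =
  poset :: "'a rel"
  oper :: "'v rel \<Rightarrow> 's \<Rightarrow> ('v \<Rightarrow> 'a) \<Rightarrow> 'a"

text \<open>The last condition fixes the irrelevant values of \<open>oper A\<close>, so that algebras with the same
  poset and the same operations are equal.\<close>

definition is_algebra ::
    "'v rel set \<Rightarrow> ('v rel \<Rightarrow> 's set) \<Rightarrow> ('v, 's, 'a) alg \<Rightarrow> bool" where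
  "is_algebra Ctx \<Sigma> A \<longleftrightarrow>
     Partial_order (poset A) \<and>
     (\<forall>\<Gamma>\<in>Ctx. \<forall>\<sigma>\<in>\<Sigma> \<Gamma>. \<forall>f\<in>monotone_maps \<Gamma> (poset A). oper A \<Gamma> \<sigma> f \<in> Field (poset A)) \<and>
     (\<forall>\<Gamma> \<sigma> f. \<not> (\<Gamma> \<in> Ctx \<and> \<sigma> \<in> \<Sigma> \<Gamma> \<and> f \<in> monotone_maps \<Gamma> (poset A)) \<longrightarrow>
        oper A \<Gamma> \<sigma> f = undefined)"

definition homomorphisms ::
    "'v rel set \<Rightarrow> ('v rel \<Rightarrow> 's set) \<Rightarrow> ('v, 's, 'a) alg \<Rightarrow> ('v, 's, 'b) alg \<Rightarrow> ('a \<Rightarrow> 'b) set" where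
  "homomorphisms Ctx \<Sigma> A B =
     {h \<in> monotone_maps (poset A) (poset B).
        \<forall>\<Gamma>\<in>Ctx. \<forall>\<sigma>\<in>\<Sigma> \<Gamma>. \<forall>f\<in>monotone_maps \<Gamma> (poset A).
          h (oper A \<Gamma> \<sigma> f) = oper B \<Gamma> \<sigma> (compose (Field \<Gamma>) h f)}"

definition Alg ::
    "'u set set \<Rightarrow> 'v rel set \<Rightarrow> ('v rel \<Rightarrow> 's set) \<Rightarrow> (('v, 's, 'u) alg, 'u \<Rightarrow> 'u) category" where
  "Alg U Ctx \<Sigma> =
     \<lparr>Obj = {A. is_algebra Ctx \<Sigma> A \<and> Field (poset A) \<in> U},
      Hom = homomorphisms Ctx \<Sigma>,
      Id = \<lambda>A. \<lambda>x\<in>Field (poset A). x,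
      Comp = \<lambda>A B D g f. compose (Field (poset A)) g f\<rparr>"


section \<open>Terms, inequations in context, varieties\<close>

datatype ('v, 's) trm = Var 'v | Op "'v rel" 's "'v \<Rightarrow> ('v, 's) trm"

inductive_set terms :: "'v rel set \<Rightarrow> ('v rel \<Rightarrow> 's set) \<Rightarrow> 'v rel \<Rightarrow> ('v, 's) trm set"
  for Ctx \<Sigma> \<Gamma> where
    Var: "x \<in> Field \<Gamma> \<Longrightarrow> Var x \<in> terms Ctx \<Sigma> \<Gamma>"
  | Op: "\<lbrakk>\<Delta> \<in> Ctx; \<sigma> \<in> \<Sigma> \<Delta>; g \<in> extensional (Field \<Delta>);
          \<And>i. i \<in> Field \<Delta> \<Longrightarrow> g i \<in> terms Ctx \<Sigma> \<Gamma>\<rbrakk> \<Longrightarrow> Op \<Delta> \<sigma> g \<in> terms Ctx \<Sigma> \<Gamma>"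

primrec eval :: "('v, 's, 'a) alg \<Rightarrow> ('v \<Rightarrow> 'a) \<Rightarrow> ('v, 's) trm \<Rightarrow> 'a option" where
  "eval A f (Var x) = Some (f x)"
| "eval A f (Op \<Delta> \<sigma> g) =
     (if (\<forall>i\<in>Field \<Delta>. eval A f (g i) \<noteq> None) \<and>
         (\<forall>i j. (i, j) \<in> \<Delta> \<longrightarrow> (the (eval A f (g i)), the (eval A f (g j))) \<in> poset A)
      then Some (oper A \<Delta> \<sigma> (\<lambda>i\<in>Field \<Delta>. the (eval A f (g i))))
      else None)"

text \<open>The triple \<open>(\<Gamma>, s, t)\<close> stands for \<open>\<Gamma> \<turnstile> s \<le> t\<close>.\<close>

type_synonym ('v, 's) inequation = "'v rel \<times> ('v, 's) trm \<times> ('v, 's) trm"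

definition inequations ::
    "'v rel set \<Rightarrow> ('v rel \<Rightarrow> 's set) \<Rightarrow> ('v, 's) inequation set" where
  "inequations Ctx \<Sigma> = {(\<Gamma>, s, t). \<Gamma> \<in> Ctx \<and> s \<in> terms Ctx \<Sigma> \<Gamma> \<and> t \<in> terms Ctx \<Sigma> \<Gamma>}"

definition satisfies :: "('v, 's, 'a) alg \<Rightarrow> ('v, 's) inequation \<Rightarrow> bool" where
  "satisfies A = (\<lambda>(\<Gamma>, s, t). \<forall>f\<in>monotone_maps \<Gamma> (poset A).
     \<exists>a b. eval A f s = Some a \<and> eval A f t = Some b \<and> (a, b) \<in> poset A)"

definition Variety ::
    "'u set set \<Rightarrow> 'v rel set \<Rightarrow> ('v rel \<Rightarrow> 's set) \<Rightarrow> ('v, 's) inequation set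
     \<Rightarrow> (('v, 's, 'u) alg, 'u \<Rightarrow> 'u) category" where
  "Variety U Ctx \<Sigma> E = full_subcategory (Alg U Ctx \<Sigma>) (\<lambda>A. \<forall>e\<in>E. satisfies A e)"

definition forgetful :: "(('v, 's, 'u) alg, 'u \<Rightarrow> 'u, 'u rel, 'u \<Rightarrow> 'u) ftor" where
  "forgetful = \<lparr>on_obj = poset, on_hom = \<lambda>A B h. h\<rparr>"

end

theory Submission
  imports Defs "HOL-Library.Countable_Set"
begin

text \<open>
  An adjunction between posets and a variety \<open>\<V>\<close>, and an inverse of its comparison functor,
  are constructed by hand; no general monadicity criterion is used.

  \<^bold>\<open>Free algebras.\<close> Because evaluation of terms is partial, free algebras are not
  described by terms modulo an inequational calculus. They are found semantically: in the product
  of all algebras \<open>A\<close> of \<open>\<V>\<close>, one copy for every monotone \<open>f : X \<rightarrow> A\<close>, take the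
  subalgebra generated by the tuples \<open>(f x)\<close>, with the order of the product. Its projections
  extend all \<open>f\<close>, uniquely because of generation, and they jointly reflect the order. The
  latter makes every inequation of \<open>\<V>\<close> hold (\<open>satisfies_cone\<close>): a term fails to be
  defined only through a missing inequality, and missing inequalities are seen by some projection.
  The product may be too large to be an object, but the generated subalgebra is small
  (\<open>small_generated\<close>), since arities are finite, there are countably many contexts and the sets of symbols are small. A
  universe need not have power sets, so this bound comes from the process of generation and not from
  the size of the product. This gives \<open>free_algebra_exists\<close>, hence an adjunction with unit \<open>\<eta>\<close>, counit
  \<open>\<epsilon>\<close> and monad \<open>T\<close>.

  \<^bold>\<open>Monadicity.\<close> An Eilenberg--Moore algebra \<open>a : T X \<rightarrow> X\<close> turns \<open>X\<close>
  into an algebra by \<open>\<sigma>(f) = a(\<sigma>(\<eta> \<circ> f))\<close>. The associativity law of \<open>a\<close> makes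
  \<open>a\<close> a homomorphism (\<open>structure_map_homomorphism\<close>), the unit law makes \<open>\<eta>\<close> a
  monotone section of it. Inequations pass along such split quotients
  (\<open>satisfies_split_quotient\<close>), so \<open>X\<close> with these operations belongs to \<open>\<V>\<close>, and
  \<open>a\<close> is its counit. The assignment is strictly inverse to \<open>A \<mapsto> (A, \<epsilon>\<^sub>A)\<close> and
  does not change maps, so the comparison functor is an isomorphism of categories.
\<close>

section \<open>Small sets\<close>

lemma small_mono: assumes "universe U" "small U T" "S \<lesssim> T" shows "small U S"
  using assms lepoll_trans unfolding small_def by blast

lemma small_image: assumes "universe U" "small U S" shows "small U (f ` S)"
  using small_mono[OF assms image_lepoll] .

lemma small_Un_universe:
  assumes U: "universe U" and A: "A \<in> U" and B: "B \<in> U"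
  shows "A \<union> B \<in> U"
proof -
  obtain N where N: "N \<in> U" "infinite N"
    using U unfolding universe_def by blast
  then obtain x y where xy: "x \<in> N" "y \<in> N" "x \<noteq> y"
    by (metis finite.emptyI finite_insert finite_subset insertCI subsetI)
  have "{x, y} \<lesssim> N" using xy by (intro subset_imp_lepoll) auto
  then have "{x, y} \<in> U" using U N unfolding universe_def by blast
  moreover have "(\<lambda>z. if z = x then A else B) ` {x, y} \<subseteq> U" using A B by auto
  ultimately have "\<Union> ((\<lambda>z. if z = x then A else B) ` {x, y}) \<in> U"
    using U unfolding universe_def by blast
  also have "\<Union> ((\<lambda>z. if z = x then A else B) ` {x, y}) = A \<union> B" using xy by auto
  finally show ?thesis .
qed

text \<open>
  A product lives on another type than its factors. Both factors embed into one infinite member of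
  the universe, which is equipotent to its own square.
\<close>

lemma small_Times:
  assumes U: "universe U" and S: "small U S" and T: "small U T"
  shows "small U (S \<times> T)"
proof -
  obtain A B where A: "A \<in> U" "S \<lesssim> A" and B: "B \<in> U" "T \<lesssim> B"
    using S T unfolding small_def by blast
  obtain N where N: "N \<in> U" "infinite N"
    using U unfolding universe_def by blast
  let ?C = "A \<union> B \<union> N"
  have C: "?C \<in> U" using small_Un_universe[OF U] A B N by blast
  have "?C \<times> ?C \<approx> ?C"
    unfolding eqpoll_iff_card_of_ordIso using N by (intro card_of_Times_same_infinite) simp
  then have *: "?C \<times> ?C \<lesssim> ?C" by (rule eqpoll_imp_lepoll)
  have "S \<times> T \<lesssim> A \<times> B" using A B by (intro times_lepoll_mono)
  also have "A \<times> B \<lesssim> ?C \<times> ?C" by (intro subset_imp_lepoll) auto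
  also note *
  finally show ?thesis using C unfolding small_def by blast
qed

text \<open>
  The union axiom concerns subsets of one type, whereas here the members of the family have any
  type. So the \<open>S i\<close> are first embedded into members \<open>A i\<close> of the universe; since
  these embeddings may collide for different \<open>i\<close>, the index is remembered as well, which
  embeds the union into \<open>I \<times> (\<Union>i\<in>I. A i)\<close>.
\<close>

lemma small_UN:
  assumes U: "universe U" and I: "small U I" and S: "\<And>i. i \<in> I \<Longrightarrow> small U (S i)"
  shows "small U (\<Union>i\<in>I. S i)"
proof -
  obtain J \<phi> where J: "J \<in> U" and \<phi>: "inj_on \<phi> I" "\<phi> ` I \<subseteq> J"
    using I unfolding small_def lepoll_def by blast
  have "\<forall>i\<in>I. \<exists>A g. A \<in> U \<and> inj_on g (S i) \<and> g ` S i \<subseteq> A"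
    using S unfolding small_def lepoll_def by blast
  then obtain A g where A: "\<And>i. i \<in> I \<Longrightarrow> A i \<in> U"
    and g: "\<And>i. i \<in> I \<Longrightarrow> inj_on (g i) (S i)" "\<And>i. i \<in> I \<Longrightarrow> g i ` S i \<subseteq> A i"
    by metis
  have "\<phi> ` I \<lesssim> J" using \<phi> by (intro subset_imp_lepoll)
  then have "\<phi> ` I \<in> U" using U J unfolding universe_def by blast
  moreover have "(\<lambda>j. A (inv_into I \<phi> j)) ` \<phi> ` I \<subseteq> U" using A \<phi> by auto
  ultimately have "\<Union> ((\<lambda>j. A (inv_into I \<phi> j)) ` \<phi> ` I) \<in> U"
    using U unfolding universe_def by blast
  also have "\<Union> ((\<lambda>j. A (inv_into I \<phi> j)) ` \<phi> ` I) = (\<Union>i\<in>I. A i)" using \<phi> by auto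
  finally have "small U (\<Union>i\<in>I. A i)" unfolding small_def by blast
  then have small: "small U (I \<times> (\<Union>i\<in>I. A i))" using small_Times[OF U I] by blast
  have "\<forall>u\<in>(\<Union>i\<in>I. S i). \<exists>i. i \<in> I \<and> u \<in> S i" by blast
  then obtain k where k: "\<And>u. u \<in> (\<Union>i\<in>I. S i) \<Longrightarrow> k u \<in> I \<and> u \<in> S (k u)" by metis
  have "inj_on (\<lambda>u. (k u, g (k u) u)) (\<Union>i\<in>I. S i)"
  proof (rule inj_onI)
    fix u v assume uv: "u \<in> (\<Union>i\<in>I. S i)" "v \<in> (\<Union>i\<in>I. S i)" "(k u, g (k u) u) = (k v, g (k v) v)"
    then have "k v = k u" "g (k u) u = g (k u) v" by auto
    then show "u = v" using k[OF uv(1)] k[OF uv(2)] g(1)[of "k u"] by (auto dest: inj_onD)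
  qed
  moreover have "(\<lambda>u. (k u, g (k u) u)) ` (\<Union>i\<in>I. S i) \<subseteq> I \<times> (\<Union>i\<in>I. A i)"
    using k g(2) by blast
  ultimately show ?thesis using small_mono[OF U small] unfolding lepoll_def by blast
qed

lemma small_countable:
  assumes U: "universe U" and S: "countable S"
  shows "small U S"
proof -
  obtain N where N: "N \<in> U" "infinite N"
    using U unfolding universe_def by blast
  obtain f :: "_ \<Rightarrow> nat" where f: "inj_on f S" using S unfolding countable_def by blast
  obtain e :: "nat \<Rightarrow> _" where e: "inj e" "range e \<subseteq> N"
    using infinite_countable_subset[OF N(2)] by blast
  have "inj_on (e \<circ> f) S" using f e(1) by (intro comp_inj_on) (auto intro: inj_on_subset)
  moreover have "(e \<circ> f) ` S \<subseteq> N" using e(2) by auto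
  ultimately show ?thesis using N unfolding small_def lepoll_def by blast
qed

lemma small_Un:
  assumes U: "universe U" and S: "small U S" and T: "small U T"
  shows "small U (S \<union> T)"
proof -
  have "small U (\<Union>b\<in>UNIV. if b then S else T)"
    by (rule small_UN[OF U]) (auto intro: small_countable[OF U] S T)
  also have "(\<Union>b\<in>UNIV. if b then S else T) = S \<union> T" by (auto split: if_splits)
  finally show ?thesis .
qed

lemma small_PiE_finite:
  assumes U: "universe U" and S: "small U S" and "finite I"
  shows "small U (I \<rightarrow>\<^sub>E S)"
  using \<open>finite I\<close>
proof induction
  case empty
  then show ?case by (intro small_countable[OF U]) (simp add: PiE_empty_domain)
next
  case (insert i I)
  show ?case unfolding PiE_insert_eq
    by (intro small_image[OF U] small_Times[OF U] S insert.IH)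
qed

text \<open>
  A context is determined by any of its isomorphic copies on natural numbers, and there are
  countably many finite relations on natural numbers.
\<close>

lemma countable_contexts:
  assumes "represents_finite_posets Ctx"
  shows "countable Ctx"
proof -
  have ex: "\<exists>P :: nat rel. finite P \<and> Partial_order P \<and> poset_iso P \<Gamma>" if \<Gamma>: "\<Gamma> \<in> Ctx" for \<Gamma>
  proof -
    have po: "Partial_order \<Gamma>" and fin: "finite (Field \<Gamma>)"
      using assms \<Gamma> unfolding represents_finite_posets_def by auto
    obtain h :: "_ \<Rightarrow> nat" where h: "inj_on h (Field \<Gamma>)"
      using finite_imp_inj_to_nat_seg[OF fin] by blast
    let ?P = "dir_image \<Gamma> h"
    have "Partial_order ?P" using Partial_order_dir_image[OF po h] .
    moreover have FP: "Field ?P = h ` Field \<Gamma>" by (rule dir_image_Field)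
    moreover have "finite ?P"
    proof (rule finite_subset)
      show "?P \<subseteq> Field ?P \<times> Field ?P" by (auto intro: FieldI1 FieldI2)
      show "finite (Field ?P \<times> Field ?P)" using fin FP by simp
    qed
    moreover have "poset_iso ?P \<Gamma>"
    proof -
      let ?k = "inv_into (Field \<Gamma>) h"
      have "bij_betw ?k (h ` Field \<Gamma>) (Field \<Gamma>)"
        using h by (intro bij_betw_inv_into) (auto simp: bij_betw_def)
      moreover have "(h a, h b) \<in> ?P \<longleftrightarrow> (a, b) \<in> \<Gamma>" if "a \<in> Field \<Gamma>" "b \<in> Field \<Gamma>" for a b
        using that h unfolding dir_image_def by (auto dest: inj_onD intro: FieldI1 FieldI2)
      ultimately show ?thesis unfolding poset_iso_def FP using h by auto
    qed
    ultimately show ?thesis by blast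
  qed
  then obtain p :: "_ \<Rightarrow> nat rel" where
    p: "\<And>\<Gamma>. \<Gamma> \<in> Ctx \<Longrightarrow> finite (p \<Gamma>) \<and> Partial_order (p \<Gamma>) \<and> poset_iso (p \<Gamma>) \<Gamma>"
    by metis
  have "inj_on p Ctx"
  proof (rule inj_onI)
    fix \<Gamma> \<Delta> assume "\<Gamma> \<in> Ctx" "\<Delta> \<in> Ctx" "p \<Gamma> = p \<Delta>"
    moreover have "\<exists>!\<Gamma>'. \<Gamma>' \<in> Ctx \<and> poset_iso (p \<Gamma>) \<Gamma>'"
      using assms p[OF \<open>\<Gamma> \<in> Ctx\<close>] finite_Field unfolding represents_finite_posets_def by blast
    ultimately show "\<Gamma> = \<Delta>" using p by metis
  qed
  moreover have "p ` Ctx \<subseteq> {P. finite P}" using p by auto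
  moreover have "countable {P :: nat rel. finite P}" by (rule countable_Collect_finite)
  ultimately show ?thesis by (metis countable_image_inj_on countable_subset)
qed


section \<open>Monotone maps\<close>

lemma monotone_maps_app: "f \<in> monotone_maps P Q \<Longrightarrow> x \<in> Field P \<Longrightarrow> f x \<in> Field Q"
  unfolding monotone_maps_def by auto

lemma monotone_maps_mono: "f \<in> monotone_maps P Q \<Longrightarrow> (x, y) \<in> P \<Longrightarrow> (f x, f y) \<in> Q"
  unfolding monotone_maps_def monotone_on_def by (auto intro: FieldI1 FieldI2)

lemma monotone_maps_extensional: "f \<in> monotone_maps P Q \<Longrightarrow> f \<in> extensional (Field P)"
  unfolding monotone_maps_def by (auto simp: PiE_def)

lemma monotone_mapsI:
  assumes "\<And>x. x \<in> Field P \<Longrightarrow> f x \<in> Field Q" "\<And>x y. (x, y) \<in> P \<Longrightarrow> (f x, f y) \<in> Q"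
    "f \<in> extensional (Field P)"
  shows "f \<in> monotone_maps P Q"
  using assms unfolding monotone_maps_def monotone_on_def by (auto simp: PiE_def)

lemma monotone_maps_eqI:
  assumes "f \<in> monotone_maps P Q" "g \<in> monotone_maps P R" "\<And>x. x \<in> Field P \<Longrightarrow> f x = g x"
  shows "f = g"
  using assms by (metis extensionalityI monotone_maps_extensional)

lemma compose_app: "x \<in> A \<Longrightarrow> compose A g f x = g (f x)"
  by (simp add: compose_def)

lemma compose_monotone_maps:
  assumes "f \<in> monotone_maps P Q" "g \<in> monotone_maps Q R"
  shows "compose (Field P) g f \<in> monotone_maps P R"
  by (rule monotone_mapsI)
    (auto simp: compose_app FieldI1 FieldI2
      intro: monotone_maps_app[OF assms(2)] monotone_maps_app[OF assms(1)]
        monotone_maps_mono[OF assms(2)] monotone_maps_mono[OF assms(1)])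

lemma restrict_monotone_maps:
  assumes "\<And>x. x \<in> Field P \<Longrightarrow> f x \<in> Field Q" "\<And>x y. (x, y) \<in> P \<Longrightarrow> (f x, f y) \<in> Q"
  shows "(\<lambda>x\<in>Field P. f x) \<in> monotone_maps P Q"
  using assms by (intro monotone_mapsI) (auto intro: FieldI1 FieldI2)

lemma id_monotone_maps: "(\<lambda>x\<in>Field P. x) \<in> monotone_maps P P"
  by (intro restrict_monotone_maps)

lemma compose_compose:
  assumes "f \<in> monotone_maps P Q"
  shows "compose (Field P) (compose (Field Q) h g) f = compose (Field P) h (compose (Field P) g f)"
  using monotone_maps_app[OF assms] by (auto simp: compose_def)

lemma compose_id_left: "f \<in> monotone_maps P Q \<Longrightarrow> compose (Field P) (\<lambda>x\<in>Field Q. x) f = f"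
  by (rule monotone_maps_eqI) (auto intro: compose_monotone_maps id_monotone_maps
      simp: compose_app monotone_maps_app)

lemma compose_id_right: "f \<in> monotone_maps P Q \<Longrightarrow> compose (Field P) f (\<lambda>x\<in>Field P. x) = f"
  by (rule monotone_maps_eqI) (auto intro: compose_monotone_maps id_monotone_maps
      simp: compose_app monotone_maps_app)

lemma partial_order_refl: "Partial_order P \<Longrightarrow> x \<in> Field P \<Longrightarrow> (x, x) \<in> P"
  by (auto simp: partial_order_on_def preorder_on_def refl_on_def)


section \<open>Homomorphisms of algebras\<close>

lemma homomorphismsI:
  assumes "h \<in> monotone_maps (poset A) (poset B)"
    "\<And>\<Gamma> \<sigma> f. \<lbrakk>\<Gamma> \<in> Ctx; \<sigma> \<in> \<Sigma> \<Gamma>; f \<in> monotone_maps \<Gamma> (poset A)\<rbrakk> \<Longrightarrow>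
      h (oper A \<Gamma> \<sigma> f) = oper B \<Gamma> \<sigma> (compose (Field \<Gamma>) h f)"
  shows "h \<in> homomorphisms Ctx \<Sigma> A B"
  using assms unfolding homomorphisms_def by blast

lemma homomorphisms_monotone: "h \<in> homomorphisms Ctx \<Sigma> A B \<Longrightarrow> h \<in> monotone_maps (poset A) (poset B)"
  unfolding homomorphisms_def by blast

lemma homomorphisms_oper:
  "\<lbrakk>h \<in> homomorphisms Ctx \<Sigma> A B; \<Gamma> \<in> Ctx; \<sigma> \<in> \<Sigma> \<Gamma>; f \<in> monotone_maps \<Gamma> (poset A)\<rbrakk> \<Longrightarrow>
    h (oper A \<Gamma> \<sigma> f) = oper B \<Gamma> \<sigma> (compose (Field \<Gamma>) h f)"
  unfolding homomorphisms_def by blast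

lemma algebra_oper:
  "\<lbrakk>is_algebra Ctx \<Sigma> A; \<Gamma> \<in> Ctx; \<sigma> \<in> \<Sigma> \<Gamma>; f \<in> monotone_maps \<Gamma> (poset A)\<rbrakk> \<Longrightarrow>
    oper A \<Gamma> \<sigma> f \<in> Field (poset A)"
  unfolding is_algebra_def by blast

lemma algebra_partial_order: "is_algebra Ctx \<Sigma> A \<Longrightarrow> Partial_order (poset A)"
  unfolding is_algebra_def by blast

lemma compose_homomorphisms:
  assumes A: "is_algebra Ctx \<Sigma> A"
    and f: "f \<in> homomorphisms Ctx \<Sigma> A B" and g: "g \<in> homomorphisms Ctx \<Sigma> B D"
  shows "compose (Field (poset A)) g f \<in> homomorphisms Ctx \<Sigma> A D"
proof (rule homomorphismsI)
  show "compose (Field (poset A)) g f \<in> monotone_maps (poset A) (poset D)"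
    using compose_monotone_maps[OF homomorphisms_monotone[OF f] homomorphisms_monotone[OF g]] .
next
  fix \<Gamma> \<sigma> k assume *: "\<Gamma> \<in> Ctx" "\<sigma> \<in> \<Sigma> \<Gamma>" "k \<in> monotone_maps \<Gamma> (poset A)"
  have "compose (Field (poset A)) g f (oper A \<Gamma> \<sigma> k) = g (oper B \<Gamma> \<sigma> (compose (Field \<Gamma>) f k))"
    using algebra_oper[OF A *] homomorphisms_oper[OF f *] by (simp add: compose_app)
  also have "\<dots> = oper D \<Gamma> \<sigma> (compose (Field \<Gamma>) g (compose (Field \<Gamma>) f k))"
    using homomorphisms_oper[OF g *(1,2) compose_monotone_maps[OF *(3) homomorphisms_monotone[OF f]]] .
  also have "compose (Field \<Gamma>) g (compose (Field \<Gamma>) f k) =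
      compose (Field \<Gamma>) (compose (Field (poset A)) g f) k"
    by (rule compose_compose[OF *(3), symmetric])
  finally show "compose (Field (poset A)) g f (oper A \<Gamma> \<sigma> k) =
      oper D \<Gamma> \<sigma> (compose (Field \<Gamma>) (compose (Field (poset A)) g f) k)" .
qed

lemma id_homomorphisms: "(\<lambda>x\<in>Field (poset A). x) \<in> homomorphisms Ctx \<Sigma> A A"
  if "is_algebra Ctx \<Sigma> A"
  using that
  by (intro homomorphismsI id_monotone_maps) (simp add: algebra_oper compose_id_left)

text \<open>
  Operations given by a formula are put into the normal form that \<^const>\<open>is_algebra\<close>
  demands, so that equality of algebras is equality of posets and of operations.
\<close>

definition mk_alg ::
    "'v rel set \<Rightarrow> ('v rel \<Rightarrow> 's set) \<Rightarrow> 'a rel \<Rightarrow> ('v rel \<Rightarrow> 's \<Rightarrow> ('v \<Rightarrow> 'a) \<Rightarrow> 'a) \<Rightarrow> ('v, 's, 'a) alg" where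
  "mk_alg Ctx \<Sigma> P op =
     \<lparr>poset = P,
      oper = \<lambda>\<Gamma> \<sigma> f. if \<Gamma> \<in> Ctx \<and> \<sigma> \<in> \<Sigma> \<Gamma> \<and> f \<in> monotone_maps \<Gamma> P then op \<Gamma> \<sigma> f else undefined\<rparr>"

lemma poset_mk_alg [simp]: "poset (mk_alg Ctx \<Sigma> P op) = P"
  by (simp add: mk_alg_def)

lemma oper_mk_alg:
  "\<lbrakk>\<Gamma> \<in> Ctx; \<sigma> \<in> \<Sigma> \<Gamma>; f \<in> monotone_maps \<Gamma> P\<rbrakk> \<Longrightarrow> oper (mk_alg Ctx \<Sigma> P op) \<Gamma> \<sigma> f = op \<Gamma> \<sigma> f"
  by (simp add: mk_alg_def)

lemma is_algebra_mk_alg: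
  assumes "Partial_order P"
    "\<And>\<Gamma> \<sigma> f. \<lbrakk>\<Gamma> \<in> Ctx; \<sigma> \<in> \<Sigma> \<Gamma>; f \<in> monotone_maps \<Gamma> P\<rbrakk> \<Longrightarrow> op \<Gamma> \<sigma> f \<in> Field P"
  shows "is_algebra Ctx \<Sigma> (mk_alg Ctx \<Sigma> P op)"
  using assms unfolding is_algebra_def by (auto simp: mk_alg_def)

lemma mk_alg_eqI:
  assumes "is_algebra Ctx \<Sigma> A"
    "\<And>\<Gamma> \<sigma> f. \<lbrakk>\<Gamma> \<in> Ctx; \<sigma> \<in> \<Sigma> \<Gamma>; f \<in> monotone_maps \<Gamma> (poset A)\<rbrakk> \<Longrightarrow> op \<Gamma> \<sigma> f = oper A \<Gamma> \<sigma> f"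
  shows "mk_alg Ctx \<Sigma> (poset A) op = A"
proof -
  have "oper (mk_alg Ctx \<Sigma> (poset A) op) = oper A"
    using assms unfolding is_algebra_def mk_alg_def by (auto intro!: ext)
  then show ?thesis by simp
qed


section \<open>Preservation of inequations\<close>

text \<open>
  Only definedness in the source carries over to the target: a homomorphism preserves the order
  but need not reflect it.
\<close>

lemma homomorphisms_eval:
  assumes A: "is_algebra Ctx \<Sigma> A" and h: "h \<in> homomorphisms Ctx \<Sigma> A B"
    and f: "f \<in> monotone_maps \<Gamma> (poset A)"
    and t: "t \<in> terms Ctx \<Sigma> \<Gamma>" and "eval A f t = Some a"
  shows "a \<in> Field (poset A) \<and> eval B (compose (Field \<Gamma>) h f) t = Some (h a)"
  using t \<open>eval A f t = Some a\<close>
proof (induction arbitrary: a)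
  case (Var x)
  then show ?case using monotone_maps_app[OF f] by (auto simp: compose_app)
next
  case (Op \<Delta> \<sigma> g)
  let ?v = "\<lambda>i. the (eval A f (g i))"
  have def: "\<forall>i\<in>Field \<Delta>. eval A f (g i) \<noteq> None"
    and mono: "\<And>i j. (i, j) \<in> \<Delta> \<Longrightarrow> (?v i, ?v j) \<in> poset A"
    and a: "a = oper A \<Delta> \<sigma> (restrict ?v (Field \<Delta>))"
    using Op.prems by (auto split: if_splits)
  have v: "?v i \<in> Field (poset A)" "eval B (compose (Field \<Gamma>) h f) (g i) = Some (h (?v i))"
    if "i \<in> Field \<Delta>" for i
    using Op.IH[OF that, of "?v i"] def that by auto
  have vm: "restrict ?v (Field \<Delta>) \<in> monotone_maps \<Delta> (poset A)"
    using v mono by (intro restrict_monotone_maps)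
  have "(h (?v i), h (?v j)) \<in> poset B" if "(i, j) \<in> \<Delta>" for i j
    using mono[OF that] h homomorphisms_monotone monotone_maps_mono by metis
  moreover have "compose (Field \<Delta>) h (restrict ?v (Field \<Delta>)) =
      (\<lambda>i\<in>Field \<Delta>. the (eval B (compose (Field \<Gamma>) h f) (g i)))"
    using v by (auto simp: compose_def)
  ultimately show ?case
    using homomorphisms_oper[OF h Op.hyps(1,2) vm] algebra_oper[OF A Op.hyps(1,2) vm] v
    by (auto simp: a FieldI1 FieldI2)
qed

lemma eval_mem:
  assumes A: "is_algebra Ctx \<Sigma> A" and f: "f \<in> monotone_maps \<Gamma> (poset A)"
    and t: "t \<in> terms Ctx \<Sigma> \<Gamma>" and "eval A f t = Some a"
  shows "a \<in> Field (poset A)"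
  using homomorphisms_eval[OF A id_homomorphisms[OF A] f t assms(4)] by blast

text \<open>
  Along the monotone section \<open>m\<close> a valuation \<open>f\<close> in \<open>B\<close> lifts to the valuation
  \<open>m \<circ> f\<close> in \<open>A\<close>, and \<open>q\<close> maps the values obtained there back to values
  under \<open>q \<circ> m \<circ> f = f\<close>. For a mere surjection the lifted valuation could fail to be monotone.
\<close>

lemma satisfies_split_quotient:
  assumes A: "is_algebra Ctx \<Sigma> A" and q: "q \<in> homomorphisms Ctx \<Sigma> A B"
    and m: "m \<in> monotone_maps (poset B) (poset A)" "\<And>y. y \<in> Field (poset B) \<Longrightarrow> q (m y) = y"
    and e: "e \<in> inequations Ctx \<Sigma>" "satisfies A e"
  shows "satisfies B e"
proof -
  obtain \<Gamma> s t where est: "e = (\<Gamma>, s, t)" and st: "s \<in> terms Ctx \<Sigma> \<Gamma>" "t \<in> terms Ctx \<Sigma> \<Gamma>"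
    using e(1) unfolding inequations_def by blast
  have "\<exists>a b. eval B f s = Some a \<and> eval B f t = Some b \<and> (a, b) \<in> poset B"
    if f: "f \<in> monotone_maps \<Gamma> (poset B)" for f
  proof -
    let ?f = "compose (Field \<Gamma>) m f"
    have mf: "?f \<in> monotone_maps \<Gamma> (poset A)" using f m(1) by (rule compose_monotone_maps)
    have qmf: "compose (Field \<Gamma>) q ?f = f"
      using mf q f m(2)
      by (intro monotone_maps_eqI[of _ \<Gamma> "poset B" _ "poset B"])
        (auto intro: compose_monotone_maps homomorphisms_monotone simp: compose_app monotone_maps_app)
    obtain a b where ab: "eval A ?f s = Some a" "eval A ?f t = Some b" "(a, b) \<in> poset A"
      using e(2) mf unfolding satisfies_def est by auto
    have "eval B f s = Some (q a)" "eval B f t = Some (q b)"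
      using homomorphisms_eval[OF A q mf st(1) ab(1)] homomorphisms_eval[OF A q mf st(2) ab(2)] qmf
      by auto
    moreover have "(q a, q b) \<in> poset B"
      using ab(3) monotone_maps_mono[OF homomorphisms_monotone[OF q]] by blast
    ultimately show ?thesis by blast
  qed
  then show ?thesis unfolding satisfies_def est by auto
qed

text \<open>
  Definedness of a term is a matter of inequalities between values of its subterms. If the
  homomorphisms \<open>h i\<close> jointly reflect the order, these inequalities may be checked after
  applying each of them. Hence varieties are closed under subalgebras (with the induced order) of
  products.
\<close>

lemma eval_defined_cone:
  assumes A: "is_algebra Ctx \<Sigma> A"
    and h: "\<And>i. i \<in> I \<Longrightarrow> h i \<in> homomorphisms Ctx \<Sigma> A (B i)"
    and reflect: "\<And>x y. \<lbrakk>x \<in> Field (poset A); y \<in> Field (poset A);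
        \<And>i. i \<in> I \<Longrightarrow> (h i x, h i y) \<in> poset (B i)\<rbrakk> \<Longrightarrow> (x, y) \<in> poset A"
    and f: "f \<in> monotone_maps \<Gamma> (poset A)"
    and t: "t \<in> terms Ctx \<Sigma> \<Gamma>"
    and "\<And>i. i \<in> I \<Longrightarrow> eval (B i) (compose (Field \<Gamma>) (h i) f) t \<noteq> None"
  shows "eval A f t \<noteq> None"
  using t assms(6)
proof induction
  case (Var x)
  then show ?case by simp
next
  case (Op \<Delta> \<sigma> g)
  let ?e = "\<lambda>p. eval (B p) (compose (Field \<Gamma>) (h p) f)"
  have B: "?e p (g i) \<noteq> None" if "p \<in> I" "i \<in> Field \<Delta>" for p i
    using Op.prems[OF that(1)] that(2) by (auto split: if_splits)
  have Bm: "(the (?e p (g i)), the (?e p (g j))) \<in> poset (B p)" if "p \<in> I" "(i, j) \<in> \<Delta>" for p i j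
    using Op.prems[OF that(1)] that(2) by (auto split: if_splits)
  have def: "eval A f (g i) \<noteq> None" if "i \<in> Field \<Delta>" for i
    using Op.IH[OF that] B that by blast
  have "(the (eval A f (g i)), the (eval A f (g j))) \<in> poset A" if ij: "(i, j) \<in> \<Delta>" for i j
  proof -
    have F: "i \<in> Field \<Delta>" "j \<in> Field \<Delta>" using ij by (auto intro: FieldI1 FieldI2)
    then obtain a b where ab: "eval A f (g i) = Some a" "eval A f (g j) = Some b" using def by blast
    have "(h p a, h p b) \<in> poset (B p)" if p: "p \<in> I" for p
      using Bm[OF p ij] homomorphisms_eval[OF A h[OF p] f Op.hyps(4)] ab F
      by auto
    moreover have "a \<in> Field (poset A)" "b \<in> Field (poset A)"
      using eval_mem[OF A f] Op.hyps(4) F ab by blast+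
    ultimately show ?thesis using reflect ab by simp
  qed
  then show ?case using def by auto
qed

lemma satisfies_cone:
  assumes A: "is_algebra Ctx \<Sigma> A"
    and h: "\<And>i. i \<in> I \<Longrightarrow> h i \<in> homomorphisms Ctx \<Sigma> A (B i)"
    and reflect: "\<And>x y. \<lbrakk>x \<in> Field (poset A); y \<in> Field (poset A);
        \<And>i. i \<in> I \<Longrightarrow> (h i x, h i y) \<in> poset (B i)\<rbrakk> \<Longrightarrow> (x, y) \<in> poset A"
    and e: "e \<in> inequations Ctx \<Sigma>" "\<And>i. i \<in> I \<Longrightarrow> satisfies (B i) e"
  shows "satisfies A e"
proof -
  obtain \<Gamma> s t where est: "e = (\<Gamma>, s, t)" and st: "s \<in> terms Ctx \<Sigma> \<Gamma>" "t \<in> terms Ctx \<Sigma> \<Gamma>"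
    using e(1) unfolding inequations_def by blast
  have "\<exists>a b. eval A f s = Some a \<and> eval A f t = Some b \<and> (a, b) \<in> poset A"
    if f: "f \<in> monotone_maps \<Gamma> (poset A)" for f
  proof -
    have B: "\<exists>a b. eval (B i) (compose (Field \<Gamma>) (h i) f) s = Some a \<and>
        eval (B i) (compose (Field \<Gamma>) (h i) f) t = Some b \<and> (a, b) \<in> poset (B i)" if "i \<in> I" for i
      using e(2)[OF that] compose_monotone_maps[OF f homomorphisms_monotone[OF h[OF that]]]
      unfolding satisfies_def est by auto
    have "eval A f s \<noteq> None"
      by (rule eval_defined_cone[OF A h reflect f st(1)]) (use B in auto)
    moreover have "eval A f t \<noteq> None"
      by (rule eval_defined_cone[OF A h reflect f st(2)]) (use B in auto)
    ultimately obtain a b where ab: "eval A f s = Some a" "eval A f t = Some b" by blast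
    have "(h i a, h i b) \<in> poset (B i)" if i: "i \<in> I" for i
      using B[OF i] homomorphisms_eval[OF A h[OF i] f st(1) ab(1)]
        homomorphisms_eval[OF A h[OF i] f st(2) ab(2)] by auto
    then have "(a, b) \<in> poset A" using reflect eval_mem[OF A f] st ab by blast
    then show ?thesis using ab by blast
  qed
  then show ?thesis unfolding satisfies_def est by auto
qed


section \<open>Products of algebras\<close>

text \<open>
  A product of algebras lives on functions from the index set, hence on a new type. The index set may
  be large: for the free algebra on \<open>X\<close> it consists of all monotone maps from \<open>X\<close> into
  algebras of the variety.
\<close>

definition prod_poset :: "'i set \<Rightarrow> ('i \<Rightarrow> 'a rel) \<Rightarrow> ('i \<Rightarrow> 'a) rel" where
  "prod_poset I P =
     {(u, v). u \<in> extensional I \<and> v \<in> extensional I \<and> (\<forall>i\<in>I. (u i, v i) \<in> P i)}"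

lemma mem_prod_poset:
  "(u, v) \<in> prod_poset I P \<longleftrightarrow> u \<in> extensional I \<and> v \<in> extensional I \<and> (\<forall>i\<in>I. (u i, v i) \<in> P i)"
  by (simp add: prod_poset_def)

lemma Field_prod_poset:
  assumes "\<And>i. i \<in> I \<Longrightarrow> Partial_order (P i)"
  shows "Field (prod_poset I P) = (\<Pi>\<^sub>E i\<in>I. Field (P i))"
proof (intro equalityI subsetI)
  fix u assume "u \<in> Field (prod_poset I P)"
  then obtain v where "(u, v) \<in> prod_poset I P \<or> (v, u) \<in> prod_poset I P"
    unfolding Field_def by blast
  then show "u \<in> (\<Pi>\<^sub>E i\<in>I. Field (P i))"
    by (auto simp: mem_prod_poset PiE_def intro: FieldI1 FieldI2)
next
  fix u assume "u \<in> (\<Pi>\<^sub>E i\<in>I. Field (P i))"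
  then have "(u, u) \<in> prod_poset I P"
    using partial_order_refl[OF assms] by (auto simp: mem_prod_poset PiE_def)
  then show "u \<in> Field (prod_poset I P)" by (rule FieldI1)
qed

lemma Partial_order_prod_poset:
  assumes po: "\<And>i. i \<in> I \<Longrightarrow> Partial_order (P i)"
  shows "Partial_order (prod_poset I P)"
  unfolding partial_order_on_def preorder_on_def
proof (intro conjI)
  let ?P = "prod_poset I P"
  show "?P \<subseteq> Field ?P \<times> Field ?P" by (auto intro: FieldI1 FieldI2)
  show "refl_on (Field ?P) ?P"
    using partial_order_refl[OF po]
    by (intro refl_onI) (auto simp: Field_prod_poset[OF po] mem_prod_poset PiE_def Pi_def)
  show "trans ?P"
  proof (rule transI)
    fix u v w assume uvw: "(u, v) \<in> ?P" "(v, w) \<in> ?P"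
    have "(u i, w i) \<in> P i" if "i \<in> I" for i
      using uvw po[OF that] that
      by (auto simp: mem_prod_poset partial_order_on_def preorder_on_def dest: transD)
    then show "(u, w) \<in> ?P" using uvw by (simp add: mem_prod_poset)
  qed
  show "antisym ?P"
  proof (rule antisymI)
    fix u v assume uv: "(u, v) \<in> ?P" "(v, u) \<in> ?P"
    have "u i = v i" if "i \<in> I" for i
      using uv po[OF that] that by (auto simp: mem_prod_poset partial_order_on_def dest: antisymD)
    then show "u = v" using uv by (auto simp: mem_prod_poset intro: extensionalityI)
  qed
qed

definition prod_alg ::
    "'v rel set \<Rightarrow> ('v rel \<Rightarrow> 's set) \<Rightarrow> 'i set \<Rightarrow> ('i \<Rightarrow> ('v, 's, 'a) alg) \<Rightarrow> ('v, 's, 'i \<Rightarrow> 'a) alg" where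
  "prod_alg Ctx \<Sigma> I B = mk_alg Ctx \<Sigma> (prod_poset I (\<lambda>i. poset (B i)))
     (\<lambda>\<Gamma> \<sigma> f. \<lambda>i\<in>I. oper (B i) \<Gamma> \<sigma> (\<lambda>x\<in>Field \<Gamma>. f x i))"

lemma poset_prod_alg:
  "(u, v) \<in> poset (prod_alg Ctx \<Sigma> I B) \<longleftrightarrow>
    u \<in> extensional I \<and> v \<in> extensional I \<and> (\<forall>i\<in>I. (u i, v i) \<in> poset (B i))"
  by (simp add: prod_alg_def mem_prod_poset)

lemma Field_prod_alg:
  assumes "\<And>i. i \<in> I \<Longrightarrow> is_algebra Ctx \<Sigma> (B i)"
  shows "Field (poset (prod_alg Ctx \<Sigma> I B)) = (\<Pi>\<^sub>E i\<in>I. Field (poset (B i)))"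
  unfolding prod_alg_def poset_mk_alg
  by (rule Field_prod_poset) (rule algebra_partial_order[OF assms])

lemma prod_alg_component:
  assumes B: "\<And>i. i \<in> I \<Longrightarrow> is_algebra Ctx \<Sigma> (B i)" and i: "i \<in> I"
    and f: "f \<in> monotone_maps \<Gamma> (poset (prod_alg Ctx \<Sigma> I B))"
  shows "(\<lambda>x\<in>Field \<Gamma>. f x i) \<in> monotone_maps \<Gamma> (poset (B i))"
proof (rule restrict_monotone_maps)
  show "f x i \<in> Field (poset (B i))" if "x \<in> Field \<Gamma>" for x
    using monotone_maps_app[OF f that] i by (auto simp: Field_prod_alg[OF B])
  show "(f x i, f y i) \<in> poset (B i)" if "(x, y) \<in> \<Gamma>" for x y
    using monotone_maps_mono[OF f that] i by (simp add: poset_prod_alg)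
qed

lemma is_algebra_prod_alg:
  assumes B: "\<And>i. i \<in> I \<Longrightarrow> is_algebra Ctx \<Sigma> (B i)"
  shows "is_algebra Ctx \<Sigma> (prod_alg Ctx \<Sigma> I B)"
  unfolding prod_alg_def
proof (rule is_algebra_mk_alg)
  show "Partial_order (prod_poset I (\<lambda>i. poset (B i)))"
    by (intro Partial_order_prod_poset algebra_partial_order[OF B])
next
  fix \<Gamma> \<sigma> f
  assume *: "\<Gamma> \<in> Ctx" "\<sigma> \<in> \<Sigma> \<Gamma>" and f: "f \<in> monotone_maps \<Gamma> (prod_poset I (\<lambda>i. poset (B i)))"
  have "oper (B i) \<Gamma> \<sigma> (\<lambda>x\<in>Field \<Gamma>. f x i) \<in> Field (poset (B i))" if "i \<in> I" for i
    by (rule algebra_oper[OF B[OF that] *], rule prod_alg_component[of I Ctx \<Sigma> B])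
      (use B that f in \<open>auto simp: prod_alg_def\<close>)
  moreover have "Field (prod_poset I (\<lambda>i. poset (B i))) = (\<Pi>\<^sub>E i\<in>I. Field (poset (B i)))"
    by (intro Field_prod_poset algebra_partial_order[OF B])
  ultimately show "(\<lambda>i\<in>I. oper (B i) \<Gamma> \<sigma> (\<lambda>x\<in>Field \<Gamma>. f x i)) \<in> Field (prod_poset I (\<lambda>i. poset (B i)))"
    by simp
qed

lemma projection_homomorphism:
  assumes B: "\<And>i. i \<in> I \<Longrightarrow> is_algebra Ctx \<Sigma> (B i)" and i: "i \<in> I"
  shows "(\<lambda>u\<in>Field (poset (prod_alg Ctx \<Sigma> I B)). u i) \<in> homomorphisms Ctx \<Sigma> (prod_alg Ctx \<Sigma> I B) (B i)"
proof (rule homomorphismsI)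
  show "(\<lambda>u\<in>Field (poset (prod_alg Ctx \<Sigma> I B)). u i) \<in>
      monotone_maps (poset (prod_alg Ctx \<Sigma> I B)) (poset (B i))"
    using i by (intro restrict_monotone_maps) (auto simp: Field_prod_alg[OF B] poset_prod_alg)
next
  fix \<Gamma> \<sigma> f
  assume *: "\<Gamma> \<in> Ctx" "\<sigma> \<in> \<Sigma> \<Gamma>" "f \<in> monotone_maps \<Gamma> (poset (prod_alg Ctx \<Sigma> I B))"
  let ?\<pi> = "\<lambda>u\<in>Field (poset (prod_alg Ctx \<Sigma> I B)). u i"
  have "?\<pi> (oper (prod_alg Ctx \<Sigma> I B) \<Gamma> \<sigma> f) = oper (prod_alg Ctx \<Sigma> I B) \<Gamma> \<sigma> f i"
    using algebra_oper[OF is_algebra_prod_alg[OF B] *] by simp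
  moreover have "oper (prod_alg Ctx \<Sigma> I B) \<Gamma> \<sigma> f i = oper (B i) \<Gamma> \<sigma> (\<lambda>x\<in>Field \<Gamma>. f x i)"
    using * i unfolding prod_alg_def by (simp add: oper_mk_alg)
  moreover have "(\<lambda>x\<in>Field \<Gamma>. f x i) = compose (Field \<Gamma>) ?\<pi> f"
    using monotone_maps_app[OF *(3)] by (auto simp: compose_def)
  ultimately show "?\<pi> (oper (prod_alg Ctx \<Sigma> I B) \<Gamma> \<sigma> f) = oper (B i) \<Gamma> \<sigma> (compose (Field \<Gamma>) ?\<pi> f)"
    by simp
qed


section \<open>Generated subalgebras\<close>

inductive_set generated ::
    "'v rel set \<Rightarrow> ('v rel \<Rightarrow> 's set) \<Rightarrow> ('v, 's, 'a) alg \<Rightarrow> 'a set \<Rightarrow> 'a set"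
  for Ctx \<Sigma> A S where
    generator: "x \<in> S \<Longrightarrow> x \<in> generated Ctx \<Sigma> A S"
  | operation: "\<lbrakk>\<Gamma> \<in> Ctx; \<sigma> \<in> \<Sigma> \<Gamma>; f \<in> monotone_maps \<Gamma> (poset A);
           \<And>x. x \<in> Field \<Gamma> \<Longrightarrow> f x \<in> generated Ctx \<Sigma> A S\<rbrakk> \<Longrightarrow>
           oper A \<Gamma> \<sigma> f \<in> generated Ctx \<Sigma> A S"

lemma generated_subset:
  assumes "is_algebra Ctx \<Sigma> A" "S \<subseteq> Field (poset A)"
  shows "generated Ctx \<Sigma> A S \<subseteq> Field (poset A)"
proof
  fix x assume "x \<in> generated Ctx \<Sigma> A S"
  then show "x \<in> Field (poset A)" by induction (use assms(2) in \<open>auto intro: algebra_oper[OF assms(1)]\<close>)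
qed

text \<open>
  As arities are finite, every generated element appears after finitely many rounds of applying
  all operations to the elements obtained so far. Each round preserves smallness, because there are
  countably many contexts, small sets of symbols, and finitely many arguments at a time. Thus a
  small set generates a small subalgebra even of a large algebra.
\<close>

lemma small_generated:
  assumes U: "universe U" and Ctx: "represents_finite_posets Ctx" and \<Sigma>: "signature U Ctx \<Sigma>"
    and S: "small U S"
  shows "small U (generated Ctx \<Sigma> A S)"
proof -
  \<comment> \<open>\<open>step\<close> is one round; it ignores monotonicity of the arguments, which only enlarges the stages.\<close>
  define step where "step T = S \<union> (\<Union>\<Gamma>\<in>Ctx. \<Union>\<sigma>\<in>\<Sigma> \<Gamma>. oper A \<Gamma> \<sigma> ` (Field \<Gamma> \<rightarrow>\<^sub>E T))" for T
  define L where "L n = (step ^^ n) {}" for n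
  have L_Suc: "L (Suc n) = step (L n)" for n by (simp add: L_def)
  have "step T \<subseteq> step T'" if "T \<subseteq> T'" for T T'
    using that PiE_mono[of _ "\<lambda>_. T" "\<lambda>_. T'"] unfolding step_def by blast
  then have "L n \<subseteq> L (Suc n)" for n by (induction n) (auto simp: L_def)
  then have L_mono: "L m \<subseteq> L n" if "m \<le> n" for m n using lift_Suc_mono_le that by metis
  have small_step: "small U (step T)" if T: "small U T" for T
  proof -
    have "small U (oper A \<Gamma> \<sigma> ` (Field \<Gamma> \<rightarrow>\<^sub>E T))" if "\<Gamma> \<in> Ctx" for \<Gamma> \<sigma>
      using Ctx that T unfolding represents_finite_posets_def
      by (intro small_image[OF U] small_PiE_finite[OF U]) auto
    then show ?thesis
      using \<Sigma> small_countable[OF U countable_contexts[OF Ctx]] unfolding step_def signature_def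
      by (intro small_Un[OF U] S small_UN[OF U]) auto
  qed
  have small_L: "small U (L n)" for n
  proof (induction n)
    case 0
    show ?case by (simp add: L_def small_countable[OF U])
  next
    case (Suc n)
    then show ?case unfolding L_Suc by (rule small_step)
  qed
  then have small: "small U (\<Union>n. L n)" by (intro small_UN[OF U small_countable[OF U countableI_type]] small_L)
  have "generated Ctx \<Sigma> A S \<subseteq> (\<Union>n. L n)"
  proof
    fix x assume "x \<in> generated Ctx \<Sigma> A S"
    then show "x \<in> (\<Union>n. L n)"
    proof induction
      case (generator x)
      then have "x \<in> L (Suc 0)" unfolding L_Suc step_def by blast
      then show ?case by blast
    next
      case (operation \<Gamma> \<sigma> f)
      have "\<forall>x\<in>Field \<Gamma>. \<exists>n. f x \<in> L n" using operation.IH by blast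
      then obtain n where n: "\<And>x. x \<in> Field \<Gamma> \<Longrightarrow> f x \<in> L (n x)" by metis
      have fin: "finite (Field \<Gamma>)" using Ctx operation(1) unfolding represents_finite_posets_def by blast
      define m where "m = Max (insert 0 (n ` Field \<Gamma>))"
      have "f x \<in> L m" if "x \<in> Field \<Gamma>" for x
      proof -
        have "n x \<le> m" using fin that unfolding m_def by (intro Max_ge) auto
        then show ?thesis using n[OF that] L_mono by blast
      qed
      then have "f \<in> Field \<Gamma> \<rightarrow>\<^sub>E L m"
        using monotone_maps_extensional[OF operation(3)] by (auto simp: PiE_def)
      then have "oper A \<Gamma> \<sigma> f \<in> L (Suc m)" unfolding L_Suc step_def using operation(1,2) by blast
      then show ?case by blast
    qed
  qed
  then show ?thesis using small_mono[OF U small] subset_imp_lepoll by blast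
qed

text \<open>
  The subalgebra of \<open>A\<close> on \<open>\<psi> ` M\<close> with the induced order, renamed along
  \<open>\<psi>\<close>. Renaming is what brings a small subalgebra on a large type back to the type of
  the universe.
\<close>

definition induced_alg ::
    "'v rel set \<Rightarrow> ('v rel \<Rightarrow> 's set) \<Rightarrow> ('v, 's, 'b) alg \<Rightarrow> ('a \<Rightarrow> 'b) \<Rightarrow> 'a set \<Rightarrow> ('v, 's, 'a) alg" where
  "induced_alg Ctx \<Sigma> A \<psi> M = mk_alg Ctx \<Sigma> {(x, y). x \<in> M \<and> y \<in> M \<and> (\<psi> x, \<psi> y) \<in> poset A}
     (\<lambda>\<Gamma> \<sigma> f. inv_into M \<psi> (oper A \<Gamma> \<sigma> (compose (Field \<Gamma>) \<psi> f)))"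

locale generated_copy =
  fixes Ctx :: "'v rel set" and \<Sigma> :: "'v rel \<Rightarrow> 's set" and A :: "('v, 's, 'b) alg"
    and S :: "'b set" and M :: "'a set" and \<psi> :: "'a \<Rightarrow> 'b"
  assumes A: "is_algebra Ctx \<Sigma> A" and S: "S \<subseteq> Field (poset A)"
    and bij: "bij_betw \<psi> M (generated Ctx \<Sigma> A S)"
begin

abbreviation "Q \<equiv> induced_alg Ctx \<Sigma> A \<psi> M"

lemma poset_Q: "(x, y) \<in> poset Q \<longleftrightarrow> x \<in> M \<and> y \<in> M \<and> (\<psi> x, \<psi> y) \<in> poset A"
  by (simp add: induced_alg_def)

lemma \<psi>_mem: "x \<in> M \<Longrightarrow> \<psi> x \<in> generated Ctx \<Sigma> A S"
  using bij by (auto dest: bij_betwE)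

lemma \<psi>_Field: "x \<in> M \<Longrightarrow> \<psi> x \<in> Field (poset A)"
  using \<psi>_mem generated_subset[OF A S] by blast

lemma inv_\<psi>: "x \<in> M \<Longrightarrow> inv_into M \<psi> (\<psi> x) = x"
  using bij by (simp add: bij_betw_inv_into_left)

lemma \<psi>_inv: "u \<in> generated Ctx \<Sigma> A S \<Longrightarrow> \<psi> (inv_into M \<psi> u) = u"
  using bij by (simp add: bij_betw_inv_into_right)

lemma inv_mem: "u \<in> generated Ctx \<Sigma> A S \<Longrightarrow> inv_into M \<psi> u \<in> M"
  using bij by (metis bij_betw_imp_surj_on inv_into_into)

lemma Field_Q: "Field (poset Q) = M"
proof (intro equalityI subsetI)
  fix x assume "x \<in> M"
  then have "(x, x) \<in> poset Q"
    using partial_order_refl[OF algebra_partial_order[OF A] \<psi>_Field] by (simp add: poset_Q)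
  then show "x \<in> Field (poset Q)" by (rule FieldI1)
qed (auto simp: Field_def poset_Q)

lemma compose_\<psi>:
  assumes "f \<in> monotone_maps \<Gamma> (poset Q)"
  shows "compose (Field \<Gamma>) \<psi> f \<in> monotone_maps \<Gamma> (poset A)"
  using monotone_maps_app[OF assms] monotone_maps_mono[OF assms]
  by (intro monotone_mapsI) (auto simp: compose_app FieldI1 FieldI2 Field_Q \<psi>_Field poset_Q)

lemma oper_generated:
  assumes "\<Gamma> \<in> Ctx" "\<sigma> \<in> \<Sigma> \<Gamma>" "f \<in> monotone_maps \<Gamma> (poset Q)"
  shows "oper A \<Gamma> \<sigma> (compose (Field \<Gamma>) \<psi> f) \<in> generated Ctx \<Sigma> A S"
  using assms monotone_maps_app[OF assms(3)]
  by (intro generated.operation compose_\<psi>) (auto simp: compose_app Field_Q \<psi>_mem)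

lemma oper_Q:
  assumes "\<Gamma> \<in> Ctx" "\<sigma> \<in> \<Sigma> \<Gamma>" "f \<in> monotone_maps \<Gamma> (poset Q)"
  shows "oper Q \<Gamma> \<sigma> f = inv_into M \<psi> (oper A \<Gamma> \<sigma> (compose (Field \<Gamma>) \<psi> f))"
  using assms unfolding induced_alg_def by (simp add: oper_mk_alg)

lemma is_algebra_Q: "is_algebra Ctx \<Sigma> Q"
proof -
  have po: "Partial_order (poset A)" using algebra_partial_order[OF A] .
  have "Partial_order (poset Q)"
    unfolding partial_order_on_def preorder_on_def
  proof (intro conjI)
    show "poset Q \<subseteq> Field (poset Q) \<times> Field (poset Q)" by (auto intro: FieldI1 FieldI2)
    show "refl_on (Field (poset Q)) (poset Q)"
      using partial_order_refl[OF po \<psi>_Field] by (intro refl_onI) (auto simp: Field_Q poset_Q)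
    show "trans (poset Q)"
      using po unfolding partial_order_on_def preorder_on_def
      by (auto simp: poset_Q intro!: transI dest: transD)
    show "antisym (poset Q)"
    proof (rule antisymI)
      fix x y assume "(x, y) \<in> poset Q" "(y, x) \<in> poset Q"
      then have "\<psi> x = \<psi> y" "x \<in> M" "y \<in> M"
        using po by (auto simp: poset_Q partial_order_on_def dest: antisymD)
      then show "x = y" using inv_\<psi> by metis
    qed
  qed
  then show ?thesis
    using inv_mem[OF oper_generated] Field_Q unfolding induced_alg_def
    by (intro is_algebra_mk_alg) simp_all
qed

lemma \<psi>_homomorphism: "(\<lambda>x\<in>M. \<psi> x) \<in> homomorphisms Ctx \<Sigma> Q A"
proof (rule homomorphismsI)
  show "(\<lambda>x\<in>M. \<psi> x) \<in> monotone_maps (poset Q) (poset A)"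
    using restrict_monotone_maps[of "poset Q" \<psi> "poset A"] by (simp add: Field_Q \<psi>_Field poset_Q)
next
  fix \<Gamma> \<sigma> f assume *: "\<Gamma> \<in> Ctx" "\<sigma> \<in> \<Sigma> \<Gamma>" "f \<in> monotone_maps \<Gamma> (poset Q)"
  have "compose (Field \<Gamma>) (\<lambda>x\<in>M. \<psi> x) f = compose (Field \<Gamma>) \<psi> f"
    using monotone_maps_app[OF *(3)] by (auto simp: compose_def Field_Q)
  then show "(\<lambda>x\<in>M. \<psi> x) (oper Q \<Gamma> \<sigma> f) = oper A \<Gamma> \<sigma> (compose (Field \<Gamma>) (\<lambda>x\<in>M. \<psi> x) f)"
    using oper_generated[OF *] by (simp add: oper_Q[OF *] inv_mem \<psi>_inv)
qed

lemma homomorphisms_eqI: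
  assumes h: "h \<in> homomorphisms Ctx \<Sigma> Q B" and k: "k \<in> homomorphisms Ctx \<Sigma> Q B"
    and eq: "\<And>s. s \<in> S \<Longrightarrow> h (inv_into M \<psi> s) = k (inv_into M \<psi> s)"
  shows "h = k"
proof (rule monotone_maps_eqI[OF homomorphisms_monotone[OF h] homomorphisms_monotone[OF k]])
  have *: "h (inv_into M \<psi> u) = k (inv_into M \<psi> u)" if "u \<in> generated Ctx \<Sigma> A S" for u
    using that
  proof induction
    case (generator u)
    then show ?case by (rule eq)
  next
    case (operation \<Gamma> \<sigma> f)
    let ?f = "\<lambda>x\<in>Field \<Gamma>. inv_into M \<psi> (f x)"
    have f: "?f \<in> monotone_maps \<Gamma> (poset Q)"
      using operation.hyps(4) monotone_maps_mono[OF operation.hyps(3)]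
      by (intro restrict_monotone_maps) (auto simp: Field_Q poset_Q inv_mem \<psi>_inv FieldI1 FieldI2)
    have "compose (Field \<Gamma>) \<psi> ?f = f"
      using operation.hyps(4) compose_\<psi>[OF f]
      by (intro monotone_maps_eqI[OF _ operation.hyps(3)]) (auto simp: compose_app \<psi>_inv)
    then have "oper Q \<Gamma> \<sigma> ?f = inv_into M \<psi> (oper A \<Gamma> \<sigma> f)"
      using oper_Q[OF operation.hyps(1,2) f] by simp
    moreover have "compose (Field \<Gamma>) h ?f = compose (Field \<Gamma>) k ?f"
      using operation.IH by (auto simp: compose_def)
    ultimately show ?case
      using homomorphisms_oper[OF h operation.hyps(1,2) f] homomorphisms_oper[OF k operation.hyps(1,2) f] by simp
  qed
  show "h x = k x" if "x \<in> Field (poset Q)" for x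
    using *[OF \<psi>_mem] that by (simp add: Field_Q inv_\<psi>)
qed

end


section \<open>Free algebras in a variety\<close>

definition is_free_algebra ::
    "'u set set \<Rightarrow> 'v rel set \<Rightarrow> ('v rel \<Rightarrow> 's set) \<Rightarrow> ('v, 's) inequation set
     \<Rightarrow> 'u rel \<Rightarrow> ('v, 's, 'u) alg \<Rightarrow> ('u \<Rightarrow> 'u) \<Rightarrow> bool" where
  "is_free_algebra U Ctx \<Sigma> E X Q \<eta> \<longleftrightarrow>
     Q \<in> Obj (Variety U Ctx \<Sigma> E) \<and> \<eta> \<in> monotone_maps X (poset Q) \<and>
     (\<forall>A\<in>Obj (Variety U Ctx \<Sigma> E). \<forall>f\<in>monotone_maps X (poset A).
        \<exists>!h. h \<in> homomorphisms Ctx \<Sigma> Q A \<and> (\<forall>x\<in>Field X. h (\<eta> x) = f x))"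

lemma Obj_Variety:
  "A \<in> Obj (Variety U Ctx \<Sigma> E) \<longleftrightarrow>
    is_algebra Ctx \<Sigma> A \<and> Field (poset A) \<in> U \<and> (\<forall>e\<in>E. satisfies A e)"
  by (auto simp: Variety_def full_subcategory_def Alg_def)

text \<open>
  Index the product by all pairs \<open>(A, f)\<close> of an algebra \<open>A\<close> in the variety and a
  monotone map \<open>f\<close> from \<open>X\<close> to \<open>A\<close>. An element \<open>x\<close> of \<open>X\<close>
  gives the tuple \<open>ins x\<close> with components \<open>f x\<close>, and the subalgebra generated by
  these tuples is free: the projection to \<open>(A, f)\<close> extends \<open>f\<close>, uniquely so because
  of generation, and all projections together reflect the order, whence the inequations hold. The
  product itself may be large, but the generated subalgebra is small and hence has a copy
  \<open>Q\<close> on a member \<open>M\<close> of the universe.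
\<close>

lemma free_algebra_exists:
  fixes U :: "'u set set" and Ctx :: "'v rel set" and \<Sigma> :: "'v rel \<Rightarrow> 's set"
    and E :: "('v, 's) inequation set" and X :: "'u rel"
  assumes U: "universe U" and Ctx: "represents_finite_posets Ctx" and \<Sigma>: "signature U Ctx \<Sigma>"
    and E: "E \<subseteq> inequations Ctx \<Sigma>" and X: "Field X \<in> U"
  shows "\<exists>Q \<eta>. is_free_algebra U Ctx \<Sigma> E X Q \<eta>"
proof -
  define I where "I = {(A, f). A \<in> Obj (Variety U Ctx \<Sigma> E) \<and> f \<in> monotone_maps X (poset A)}"
  define P where "P = prod_alg Ctx \<Sigma> I fst"
  have I: "is_algebra Ctx \<Sigma> (fst i)" "\<And>e. e \<in> E \<Longrightarrow> satisfies (fst i) e"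
    "snd i \<in> monotone_maps X (poset (fst i))" if "i \<in> I" for i
    using that unfolding I_def by (auto simp: Obj_Variety)
  define ins where "ins x = (\<lambda>i\<in>I. snd i x)" for x
  have P: "is_algebra Ctx \<Sigma> P" unfolding P_def by (rule is_algebra_prod_alg[OF I(1)])
  have Field_P: "Field (poset P) = (\<Pi>\<^sub>E i\<in>I. Field (poset (fst i)))"
    unfolding P_def by (rule Field_prod_alg[OF I(1)])
  have ins: "ins ` Field X \<subseteq> Field (poset P)"
    using monotone_maps_app[OF I(3)] unfolding ins_def by (auto simp: Field_P)
  let ?G = "generated Ctx \<Sigma> P (ins ` Field X)"
  have "small U (Field X)" using X lepoll_refl unfolding small_def by blast
  then have "small U ?G" by (intro small_generated[OF U Ctx \<Sigma>] small_image[OF U])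
  then obtain B \<phi> where B: "B \<in> U" and \<phi>: "inj_on \<phi> ?G" "\<phi> ` ?G \<subseteq> B"
    unfolding small_def lepoll_def by blast
  define M where "M = \<phi> ` ?G"
  define \<psi> where "\<psi> = inv_into ?G \<phi>"
  have "M \<lesssim> B" using \<phi>(2) unfolding M_def by (rule subset_imp_lepoll)
  then have MU: "M \<in> U" using U B unfolding universe_def by blast
  interpret generated_copy Ctx \<Sigma> P "ins ` Field X" M \<psi>
    using P ins \<phi> by unfold_locales (auto simp: M_def \<psi>_def bij_betw_inv_into inj_on_imp_bij_betw)
  define \<pi> where "\<pi> i = compose M (\<lambda>u\<in>Field (poset P). u i) (\<lambda>x\<in>M. \<psi> x)" for i
  have \<pi>: "\<pi> i \<in> homomorphisms Ctx \<Sigma> Q (fst i)" if "i \<in> I" for i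
  proof -
    have "(\<lambda>u\<in>Field (poset P). u i) \<in> homomorphisms Ctx \<Sigma> P (fst i)"
      unfolding P_def by (rule projection_homomorphism[OF I(1) that])
    from compose_homomorphisms[OF is_algebra_Q \<psi>_homomorphism this]
    show ?thesis unfolding \<pi>_def Field_Q .
  qed
  have \<pi>_app: "\<pi> i x = \<psi> x i" if "x \<in> M" for i x
    using that \<psi>_Field by (simp add: \<pi>_def compose_app)
  have reflect: "(x, y) \<in> poset Q"
    if "x \<in> Field (poset Q)" "y \<in> Field (poset Q)" "\<And>i. i \<in> I \<Longrightarrow> (\<pi> i x, \<pi> i y) \<in> poset (fst i)" for x y
  proof -
    have M: "x \<in> M" "y \<in> M" using that(1,2) by (simp_all add: Field_Q)
    have "(\<psi> x i, \<psi> y i) \<in> poset (fst i)" if "i \<in> I" for i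
      using \<open>\<And>i. i \<in> I \<Longrightarrow> (\<pi> i x, \<pi> i y) \<in> poset (fst i)\<close>[OF that] M by (simp add: \<pi>_app)
    moreover have "\<psi> x \<in> extensional I" "\<psi> y \<in> extensional I"
      using M[THEN \<psi>_Field] by (auto simp: Field_P PiE_def)
    ultimately have "(\<psi> x, \<psi> y) \<in> poset P" unfolding P_def poset_prod_alg by blast
    then show ?thesis using M by (simp add: poset_Q)
  qed
  have "satisfies Q e" if "e \<in> E" for e
    using that E by (intro satisfies_cone[OF is_algebra_Q \<pi> reflect] I(2)) auto
  then have "Q \<in> Obj (Variety U Ctx \<Sigma> E)"
    using is_algebra_Q MU by (simp add: Obj_Variety Field_Q)
  moreover
  define \<eta> where "\<eta> = (\<lambda>x\<in>Field X. inv_into M \<psi> (ins x))"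
  have ins_gen: "ins x \<in> ?G" if "x \<in> Field X" for x using that by (intro generated.generator) simp
  have \<eta>_mem: "\<eta> x \<in> M" and \<psi>_\<eta>: "\<psi> (\<eta> x) = ins x" if "x \<in> Field X" for x
    using that ins_gen by (simp_all add: \<eta>_def inv_mem \<psi>_inv)
  have \<pi>_\<eta>: "\<pi> i (\<eta> x) = snd i x" if "i \<in> I" "x \<in> Field X" for i x
    using that by (simp add: \<pi>_app \<eta>_mem \<psi>_\<eta> ins_def)
  have "(\<eta> x, \<eta> y) \<in> poset Q" if xy: "(x, y) \<in> X" for x y
  proof (rule reflect)
    have F: "x \<in> Field X" "y \<in> Field X" using xy by (auto intro: FieldI1 FieldI2)
    then show "\<eta> x \<in> Field (poset Q)" "\<eta> y \<in> Field (poset Q)" by (simp_all add: Field_Q \<eta>_mem)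
    show "(\<pi> i (\<eta> x), \<pi> i (\<eta> y)) \<in> poset (fst i)" if "i \<in> I" for i
      using monotone_maps_mono[OF I(3)[OF that] xy] that F by (simp add: \<pi>_\<eta>)
  qed
  then have "\<eta> \<in> monotone_maps X (poset Q)"
    by (intro monotone_mapsI) (auto simp: Field_Q \<eta>_mem, simp add: \<eta>_def)
  moreover have "\<exists>!h. h \<in> homomorphisms Ctx \<Sigma> Q A \<and> (\<forall>x\<in>Field X. h (\<eta> x) = f x)"
    if "A \<in> Obj (Variety U Ctx \<Sigma> E)" "f \<in> monotone_maps X (poset A)" for A f
  proof (rule ex1I)
    have i: "(A, f) \<in> I" using that unfolding I_def by simp
    show "\<pi> (A, f) \<in> homomorphisms Ctx \<Sigma> Q A \<and> (\<forall>x\<in>Field X. \<pi> (A, f) (\<eta> x) = f x)"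
      using \<pi>[OF i] \<pi>_\<eta>[OF i] by simp
    fix h assume h: "h \<in> homomorphisms Ctx \<Sigma> Q A \<and> (\<forall>x\<in>Field X. h (\<eta> x) = f x)"
    then show "h = \<pi> (A, f)"
      using \<pi>[OF i] \<pi>_\<eta>[OF i] by (intro homomorphisms_eqI[of h A]) (auto simp: \<eta>_def)
  qed
  ultimately show ?thesis unfolding is_free_algebra_def by blast
qed


section \<open>The categories involved\<close>

lemma is_functor_comp:
  assumes F: "is_functor C D F" and G: "is_functor D B G"
  shows "is_functor C B (comp_ftor G F)"
  using F G unfolding is_functor_def comp_ftor_def by simp

lemma is_functor_id: "is_category C \<Longrightarrow> is_functor C C id_ftor"
  unfolding is_functor_def id_ftor_def is_category_def by simp

lemma is_category_EM:
  assumes T: "is_functor C C T"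
  shows "is_category (EM_category C T \<eta> \<mu>)"
proof -
  have C: "is_category C" using T unfolding is_functor_def by blast
  have comp: "Comp C X Y Z g f \<in> Hom C X Z"
    if "X \<in> Obj C" "Y \<in> Obj C" "Z \<in> Obj C" "f \<in> Hom C X Y" "g \<in> Hom C Y Z" for X Y Z f g
    using C that unfolding is_category_def by blast
  have assoc: "Comp C W X Z (Comp C X Y Z h g) f = Comp C W Y Z h (Comp C W X Y g f)"
    if "W \<in> Obj C" "X \<in> Obj C" "Y \<in> Obj C" "Z \<in> Obj C"
      "f \<in> Hom C W X" "g \<in> Hom C X Y" "h \<in> Hom C Y Z" for W X Y Z f g h
    using C that unfolding is_category_def by blast
  have unit: "Comp C X X Y f (Id C X) = f" "Comp C X Y Y (Id C Y) f = f"
    if "X \<in> Obj C" "Y \<in> Obj C" "f \<in> Hom C X Y" for X Y f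
    using C that unfolding is_category_def by blast+
  have Id: "Id C X \<in> Hom C X X" if "X \<in> Obj C" for X
    using C that unfolding is_category_def by blast
  have T_obj: "on_obj T X \<in> Obj C" if "X \<in> Obj C" for X
    using T that unfolding is_functor_def by blast
  have T_hom: "on_hom T X Y f \<in> Hom C (on_obj T X) (on_obj T Y)"
    if "X \<in> Obj C" "Y \<in> Obj C" "f \<in> Hom C X Y" for X Y f
    using T that unfolding is_functor_def by blast
  have T_Id: "on_hom T X X (Id C X) = Id C (on_obj T X)" if "X \<in> Obj C" for X
    using T that unfolding is_functor_def by blast
  have T_comp: "on_hom T X Z (Comp C X Y Z g f) =
      Comp C (on_obj T X) (on_obj T Y) (on_obj T Z) (on_hom T Y Z g) (on_hom T X Y f)"
    if "X \<in> Obj C" "Y \<in> Obj C" "Z \<in> Obj C" "f \<in> Hom C X Y" "g \<in> Hom C Y Z" for X Y Z f g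
    using T that unfolding is_functor_def by blast
  \<comment> \<open>The commuting squares of \<open>f\<close> and \<open>g\<close> are pasted along \<open>b\<close>.\<close>
  have square: "Comp C (on_obj T X) X Z (Comp C X Y Z g f) a =
      Comp C (on_obj T X) (on_obj T Z) Z c (on_hom T X Z (Comp C X Y Z g f))"
    if obj: "X \<in> Obj C" "Y \<in> Obj C" "Z \<in> Obj C"
      and a: "a \<in> Hom C (on_obj T X) X" and b: "b \<in> Hom C (on_obj T Y) Y" and c: "c \<in> Hom C (on_obj T Z) Z"
      and f: "f \<in> Hom C X Y" "Comp C (on_obj T X) X Y f a = Comp C (on_obj T X) (on_obj T Y) Y b (on_hom T X Y f)"
      and g: "g \<in> Hom C Y Z" "Comp C (on_obj T Y) Y Z g b = Comp C (on_obj T Y) (on_obj T Z) Z c (on_hom T Y Z g)"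
    for X Y Z a b c f g
  proof -
    note TX = T_obj[OF obj(1)] and TY = T_obj[OF obj(2)] and TZ = T_obj[OF obj(3)]
    note Tf = T_hom[OF obj(1,2) f(1)] and Tg = T_hom[OF obj(2,3) g(1)]
    show ?thesis
      unfolding assoc[OF TX obj a f(1) g(1)] f(2) T_comp[OF obj f(1) g(1)]
        assoc[OF TX TY obj(2,3) Tf b g(1), symmetric] g(2) assoc[OF TX TY TZ obj(3) Tf Tg c] ..
  qed
  show ?thesis
    unfolding is_category_def EM_category_def
    by (auto simp: Id unit T_Id T_obj comp intro: square assoc)
qed

lemma Pos_simps [simp]:
  "X \<in> Obj (Pos U) \<longleftrightarrow> Partial_order X \<and> Field X \<in> U"
  "Hom (Pos U) = monotone_maps"
  "Id (Pos U) X = (\<lambda>x\<in>Field X. x)"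
  "Comp (Pos U) X Y Z g f = compose (Field X) g f"
  by (simp_all add: Pos_def)

lemma Variety_simps [simp]:
  "Hom (Variety U Ctx \<Sigma> E) = homomorphisms Ctx \<Sigma>"
  "Id (Variety U Ctx \<Sigma> E) A = (\<lambda>x\<in>Field (poset A). x)"
  "Comp (Variety U Ctx \<Sigma> E) A B D g f = compose (Field (poset A)) g f"
  by (simp_all add: Variety_def full_subcategory_def Alg_def)

lemma is_category_Pos: "is_category (Pos U)"
  unfolding is_category_def
  by (auto simp: id_monotone_maps compose_id_left compose_id_right compose_compose
      intro: compose_monotone_maps)

lemma is_category_Variety: "is_category (Variety U Ctx \<Sigma> E)"
  unfolding is_category_def
  by (auto simp: Obj_Variety id_homomorphisms compose_id_left[OF homomorphisms_monotone]
      compose_id_right[OF homomorphisms_monotone] compose_compose[OF homomorphisms_monotone]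
      intro: compose_homomorphisms)

lemma is_functor_forgetful: "is_functor (Variety U Ctx \<Sigma> E) (Pos U) forgetful"
  unfolding is_functor_def
  by (auto simp: forgetful_def is_category_Pos is_category_Variety Obj_Variety
      intro: algebra_partial_order homomorphisms_monotone)


section \<open>The free--forgetful adjunction\<close>

text \<open>
  From here on only the universal property of the free algebras matters, not their construction.
  Two homomorphisms on a free algebra agree once they agree on generators; each law of the
  adjunction and of the comparison functor that concerns maps out of a free algebra is checked in
  this way.
\<close>

locale free_algebras =
  fixes U :: "'u set set" and Ctx :: "'v rel set" and \<Sigma> :: "'v rel \<Rightarrow> 's set"
    and E :: "('v, 's) inequation set"
    and Fr :: "'u rel \<Rightarrow> ('v, 's, 'u) alg" and \<eta> :: "'u rel \<Rightarrow> 'u \<Rightarrow> 'u"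
  assumes E: "E \<subseteq> inequations Ctx \<Sigma>"
    and free: "X \<in> Obj (Pos U) \<Longrightarrow> is_free_algebra U Ctx \<Sigma> E X (Fr X) (\<eta> X)"
begin

abbreviation "\<V> \<equiv> Variety U Ctx \<Sigma> E"

definition lift :: "'u rel \<Rightarrow> ('v, 's, 'u) alg \<Rightarrow> ('u \<Rightarrow> 'u) \<Rightarrow> 'u \<Rightarrow> 'u" where
  "lift X A f = (THE h. h \<in> homomorphisms Ctx \<Sigma> (Fr X) A \<and> (\<forall>x\<in>Field X. h (\<eta> X x) = f x))"

definition F :: "('u rel, 'u \<Rightarrow> 'u, ('v, 's, 'u) alg, 'u \<Rightarrow> 'u) ftor" where
  "F = \<lparr>on_obj = Fr, on_hom = \<lambda>X Y f. lift X (Fr Y) (compose (Field X) (\<eta> Y) f)\<rparr>"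

definition \<epsilon> :: "('v, 's, 'u) alg \<Rightarrow> 'u \<Rightarrow> 'u" where
  "\<epsilon> A = lift (poset A) A (\<lambda>x\<in>Field (poset A). x)"

lemma on_obj_F [simp]: "on_obj F = Fr"
  by (simp add: F_def)

lemma on_obj_forgetful [simp]: "on_obj forgetful = poset"
  by (simp add: forgetful_def)

lemma on_hom_forgetful [simp]: "on_hom forgetful A B h = h"
  by (simp add: forgetful_def)

lemma poset_Obj: "A \<in> Obj \<V> \<Longrightarrow> poset A \<in> Obj (Pos U)"
  using algebra_partial_order by (auto simp: Obj_Variety)

lemma Obj_algebra: "A \<in> Obj \<V> \<Longrightarrow> is_algebra Ctx \<Sigma> A"
  by (simp add: Obj_Variety)

context
  fixes X assumes X: "X \<in> Obj (Pos U)"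
begin

lemma Fr_Obj: "Fr X \<in> Obj \<V>"
  using free[OF X] unfolding is_free_algebra_def by blast

lemma \<eta>_monotone: "\<eta> X \<in> monotone_maps X (poset (Fr X))"
  using free[OF X] unfolding is_free_algebra_def by blast

lemma \<eta>_mem: "x \<in> Field X \<Longrightarrow> \<eta> X x \<in> Field (poset (Fr X))"
  using \<eta>_monotone by (rule monotone_maps_app)

lemma
  assumes A: "A \<in> Obj \<V>" and f: "f \<in> monotone_maps X (poset A)"
  shows lift_homomorphism: "lift X A f \<in> homomorphisms Ctx \<Sigma> (Fr X) A"
    and lift_\<eta>: "x \<in> Field X \<Longrightarrow> lift X A f (\<eta> X x) = f x"
proof -
  have "\<exists>!h. h \<in> homomorphisms Ctx \<Sigma> (Fr X) A \<and> (\<forall>x\<in>Field X. h (\<eta> X x) = f x)"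
    using free[OF X] A f unfolding is_free_algebra_def by blast
  from theI'[OF this]
  show "lift X A f \<in> homomorphisms Ctx \<Sigma> (Fr X) A"
    and "x \<in> Field X \<Longrightarrow> lift X A f (\<eta> X x) = f x"
    unfolding lift_def by blast+
qed

lemma free_homomorphisms_eqI:
  assumes A: "A \<in> Obj \<V>"
    and h: "h \<in> homomorphisms Ctx \<Sigma> (Fr X) A" and k: "k \<in> homomorphisms Ctx \<Sigma> (Fr X) A"
    and eq: "\<And>x. x \<in> Field X \<Longrightarrow> h (\<eta> X x) = k (\<eta> X x)"
  shows "h = k"
proof -
  let ?f = "compose (Field X) k (\<eta> X)"
  have "?f \<in> monotone_maps X (poset A)"
    using compose_monotone_maps[OF \<eta>_monotone homomorphisms_monotone[OF k]] .
  then have "\<exists>!h. h \<in> homomorphisms Ctx \<Sigma> (Fr X) A \<and> (\<forall>x\<in>Field X. h (\<eta> X x) = ?f x)"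
    using free[OF X] A unfolding is_free_algebra_def by blast
  then show ?thesis using h k eq by (auto simp: compose_app)
qed

lemma
  assumes Y: "Y \<in> Obj (Pos U)" and f: "f \<in> monotone_maps X Y"
  shows F_homomorphism: "on_hom F X Y f \<in> homomorphisms Ctx \<Sigma> (Fr X) (Fr Y)"
    and F_\<eta>: "x \<in> Field X \<Longrightarrow> on_hom F X Y f (\<eta> X x) = \<eta> Y (f x)"
proof -
  have FY: "Fr Y \<in> Obj \<V>" and \<eta>Y: "\<eta> Y \<in> monotone_maps Y (poset (Fr Y))"
    using free[OF Y] unfolding is_free_algebra_def by blast+
  have m: "compose (Field X) (\<eta> Y) f \<in> monotone_maps X (poset (Fr Y))"
    using f \<eta>Y by (rule compose_monotone_maps)
  show "on_hom F X Y f \<in> homomorphisms Ctx \<Sigma> (Fr X) (Fr Y)"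
    using lift_homomorphism[OF FY m] by (simp add: F_def)
  show "on_hom F X Y f (\<eta> X x) = \<eta> Y (f x)" if "x \<in> Field X"
    using lift_\<eta>[OF FY m that] that by (simp add: F_def compose_app)
qed

end

lemma
  assumes A: "A \<in> Obj \<V>"
  shows \<epsilon>_homomorphism: "\<epsilon> A \<in> homomorphisms Ctx \<Sigma> (Fr (poset A)) A"
    and \<epsilon>_\<eta>: "x \<in> Field (poset A) \<Longrightarrow> \<epsilon> A (\<eta> (poset A) x) = x"
  using lift_homomorphism[OF poset_Obj[OF A] A id_monotone_maps] lift_\<eta>[OF poset_Obj[OF A] A id_monotone_maps]
  by (simp_all add: \<epsilon>_def)

lemma is_functor_F: "is_functor (Pos U) \<V> F"
  unfolding is_functor_def
proof (intro conjI ballI)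
  fix X Y f assume X: "X \<in> Obj (Pos U)" and Y: "Y \<in> Obj (Pos U)" and f: "f \<in> Hom (Pos U) X Y"
  then show "on_hom F X Y f \<in> Hom \<V> (on_obj F X) (on_obj F Y)" using F_homomorphism by simp
  fix Z g assume Z: "Z \<in> Obj (Pos U)" and g: "g \<in> Hom (Pos U) Y Z"
  have fm: "f \<in> monotone_maps X Y" and gm: "g \<in> monotone_maps Y Z" using f g by simp_all
  note gf = compose_monotone_maps[OF fm gm]
  note Ff = F_homomorphism[OF X Y fm] and Fg = F_homomorphism[OF Y Z gm]
  show "on_hom F X Z (Comp (Pos U) X Y Z g f) =
      Comp \<V> (on_obj F X) (on_obj F Y) (on_obj F Z) (on_hom F Y Z g) (on_hom F X Y f)"
    unfolding Pos_simps Variety_simps on_obj_F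
  proof (rule free_homomorphisms_eqI[OF X Fr_Obj[OF Z] F_homomorphism[OF X Z gf]
        compose_homomorphisms[OF Obj_algebra[OF Fr_Obj[OF X]] Ff Fg]])
    fix x assume x: "x \<in> Field X"
    show "on_hom F X Z (compose (Field X) g f) (\<eta> X x) =
        compose (Field (poset (Fr X))) (on_hom F Y Z g) (on_hom F X Y f) (\<eta> X x)"
      using x monotone_maps_app[OF fm x]
      by (simp add: F_\<eta>[OF X Z gf] F_\<eta>[OF X Y fm] F_\<eta>[OF Y Z gm] compose_app \<eta>_mem[OF X])
  qed
next
  fix X assume X: "X \<in> Obj (Pos U)"
  then show "on_obj F X \<in> Obj \<V>" using Fr_Obj by simp
  show "on_hom F X X (Id (Pos U) X) = Id \<V> (on_obj F X)"
    unfolding Pos_simps Variety_simps on_obj_F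
    by (rule free_homomorphisms_eqI[OF X Fr_Obj[OF X] F_homomorphism[OF X X id_monotone_maps]
          id_homomorphisms[OF Obj_algebra[OF Fr_Obj[OF X]]]])
      (simp add: F_\<eta>[OF X X id_monotone_maps] \<eta>_mem[OF X])
qed (rule is_category_Pos is_category_Variety)+

abbreviation "T \<equiv> comp_ftor forgetful F"

lemma T_simps [simp]: "on_obj T X = poset (Fr X)" "on_hom T X Y f = on_hom F X Y f"
  by (simp_all add: comp_ftor_def)

lemma \<epsilon>_natural:
  assumes A: "A \<in> Obj \<V>" and B: "B \<in> Obj \<V>" and h: "h \<in> homomorphisms Ctx \<Sigma> A B"
  shows "compose (Field (poset (Fr (poset A)))) h (\<epsilon> A) =
    compose (Field (poset (Fr (poset A)))) (\<epsilon> B) (on_hom F (poset A) (poset B) h)"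
proof -
  note pA = poset_Obj[OF A] and pB = poset_Obj[OF B] and hm = homomorphisms_monotone[OF h]
  note alg = Obj_algebra[OF Fr_Obj[OF pA]]
  show ?thesis
  proof (rule free_homomorphisms_eqI[OF pA B compose_homomorphisms[OF alg \<epsilon>_homomorphism[OF A] h]
        compose_homomorphisms[OF alg F_homomorphism[OF pA pB hm] \<epsilon>_homomorphism[OF B]]])
    fix x assume x: "x \<in> Field (poset A)"
    then show "compose (Field (poset (Fr (poset A)))) h (\<epsilon> A) (\<eta> (poset A) x) =
        compose (Field (poset (Fr (poset A)))) (\<epsilon> B) (on_hom F (poset A) (poset B) h) (\<eta> (poset A) x)"
      using monotone_maps_app[OF hm x]
      by (simp add: compose_app \<eta>_mem[OF pA] F_\<eta>[OF pA pB hm] \<epsilon>_\<eta>[OF A] \<epsilon>_\<eta>[OF B])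
  qed
qed

lemma free_forgetful_adjunction: "adjunction (Pos U) \<V> F forgetful \<eta> \<epsilon>"
  unfolding adjunction_def
proof (intro conjI ballI)
  show "is_functor (Pos U) \<V> F" by (rule is_functor_F)
  show "is_functor \<V> (Pos U) forgetful" by (rule is_functor_forgetful)
  show "nat_trans (Pos U) (Pos U) id_ftor T \<eta>"
    unfolding nat_trans_def
  proof (intro conjI ballI)
    show "is_functor (Pos U) (Pos U) id_ftor" by (intro is_functor_id is_category_Pos)
    show "is_functor (Pos U) (Pos U) T" by (intro is_functor_comp[OF is_functor_F is_functor_forgetful])
    fix X assume X: "X \<in> Obj (Pos U)"
    then show "\<eta> X \<in> Hom (Pos U) (on_obj id_ftor X) (on_obj T X)"
      using \<eta>_monotone by (simp add: id_ftor_def)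
    fix Y f assume Y: "Y \<in> Obj (Pos U)" and f: "f \<in> Hom (Pos U) X Y"
    then have fm: "f \<in> monotone_maps X Y" by simp
    have "compose (Field X) (\<eta> Y) f = compose (Field X) (on_hom F X Y f) (\<eta> X)"
      by (auto simp: compose_def F_\<eta>[OF X Y fm])
    then show "Comp (Pos U) (on_obj id_ftor X) (on_obj id_ftor Y) (on_obj T Y) (\<eta> Y) (on_hom id_ftor X Y f) =
        Comp (Pos U) (on_obj id_ftor X) (on_obj T X) (on_obj T Y) (on_hom T X Y f) (\<eta> X)"
      by (simp add: id_ftor_def)
  qed
  show "nat_trans \<V> \<V> (comp_ftor F forgetful) id_ftor \<epsilon>"
    unfolding nat_trans_def
  proof (intro conjI ballI)
    show "is_functor \<V> \<V> (comp_ftor F forgetful)"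
      by (intro is_functor_comp[OF is_functor_forgetful is_functor_F])
    show "is_functor \<V> \<V> id_ftor" by (intro is_functor_id is_category_Variety)
    fix A assume A: "A \<in> Obj \<V>"
    then show "\<epsilon> A \<in> Hom \<V> (on_obj (comp_ftor F forgetful) A) (on_obj id_ftor A)"
      using \<epsilon>_homomorphism by (simp add: id_ftor_def comp_ftor_def)
    fix B h assume B: "B \<in> Obj \<V>" and h: "h \<in> Hom \<V> A B"
    then show "Comp \<V> (on_obj (comp_ftor F forgetful) A) (on_obj (comp_ftor F forgetful) B) (on_obj id_ftor B)
          (\<epsilon> B) (on_hom (comp_ftor F forgetful) A B h) =
        Comp \<V> (on_obj (comp_ftor F forgetful) A) (on_obj id_ftor A) (on_obj id_ftor B)
          (on_hom id_ftor A B h) (\<epsilon> A)"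
      using \<epsilon>_natural[OF A B] by (simp add: id_ftor_def comp_ftor_def)
  qed
next
  fix X assume X: "X \<in> Obj (Pos U)"
  note FX = Fr_Obj[OF X]
  note TX = poset_Obj[OF FX]
  note F\<eta> = F_homomorphism[OF X TX \<eta>_monotone[OF X]]
  have "compose (Field (poset (Fr X))) (\<epsilon> (Fr X)) (on_hom F X (poset (Fr X)) (\<eta> X)) =
      (\<lambda>u\<in>Field (poset (Fr X)). u)"
    by (rule free_homomorphisms_eqI[OF X FX compose_homomorphisms[OF Obj_algebra[OF FX] F\<eta> \<epsilon>_homomorphism[OF FX]]
          id_homomorphisms[OF Obj_algebra[OF FX]]])
      (simp add: compose_app \<eta>_mem[OF X] F_\<eta>[OF X TX \<eta>_monotone[OF X]] \<epsilon>_\<eta>[OF FX])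
  then show "let FX = on_obj F X; GFX = on_obj forgetful FX; FGFX = on_obj F GFX
      in Comp \<V> FX FGFX FX (\<epsilon> FX) (on_hom F X GFX (\<eta> X)) = Id \<V> FX"
    by (simp add: Let_def)
next
  fix A assume A: "A \<in> Obj \<V>"
  have "compose (Field (poset A)) (\<epsilon> A) (\<eta> (poset A)) = (\<lambda>x\<in>Field (poset A). x)"
    by (auto simp: compose_def \<epsilon>_\<eta>[OF A])
  then show "let GA = on_obj forgetful A; FGA = on_obj F GA; GFGA = on_obj forgetful FGA
      in Comp (Pos U) GA GFGA GA (on_hom forgetful FGA A (\<epsilon> A)) (\<eta> GA) = Id (Pos U) GA"
    by (simp add: Let_def)
qed


section \<open>Algebras of the monad\<close>

abbreviation "EM \<equiv> EM_category (Pos U) T \<eta> (adj_mult F forgetful \<epsilon>)"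

lemma Obj_EM:
  "(X, a) \<in> Obj EM \<longleftrightarrow> X \<in> Obj (Pos U) \<and> a \<in> monotone_maps (poset (Fr X)) X \<and>
    compose (Field X) a (\<eta> X) = (\<lambda>x\<in>Field X. x) \<and>
    compose (Field (poset (Fr (poset (Fr X))))) a (on_hom F (poset (Fr X)) X a) =
    compose (Field (poset (Fr (poset (Fr X))))) a (\<epsilon> (Fr X))"
  by (auto simp: EM_category_def adj_mult_def)

lemma Hom_EM:
  "h \<in> Hom EM (X, a) (Y, b) \<longleftrightarrow> h \<in> monotone_maps X Y \<and>
    compose (Field (poset (Fr X))) h a = compose (Field (poset (Fr X))) b (on_hom F X Y h)"
  by (auto simp: EM_category_def)

lemma Id_Comp_EM [simp]:
  "Id EM (X, a) = (\<lambda>x\<in>Field X. x)"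
  "Comp EM (X, a) (Y, b) (Z, c) g f = compose (Field X) g f"
  by (simp_all add: EM_category_def)

text \<open>
  The algebra structure encoded by an Eilenberg--Moore algebra \<open>a : T X \<rightarrow> X\<close>: apply
  the operation to generators of the free algebra on \<open>X\<close>, then collapse by \<open>a\<close>. This
  formula is forced, since \<open>a\<close> is to become a homomorphism with \<open>a \<circ> \<eta> = id\<close>.
\<close>

definition EM_alg :: "'u rel \<Rightarrow> ('u \<Rightarrow> 'u) \<Rightarrow> ('v, 's, 'u) alg" where
  "EM_alg X a = mk_alg Ctx \<Sigma> X (\<lambda>\<Gamma> \<sigma> f. a (oper (Fr X) \<Gamma> \<sigma> (compose (Field \<Gamma>) (\<eta> X) f)))"

lemma poset_EM_alg [simp]: "poset (EM_alg X a) = X"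
  by (simp add: EM_alg_def)

lemma oper_EM_alg:
  "\<lbrakk>\<Gamma> \<in> Ctx; \<sigma> \<in> \<Sigma> \<Gamma>; f \<in> monotone_maps \<Gamma> X\<rbrakk> \<Longrightarrow>
    oper (EM_alg X a) \<Gamma> \<sigma> f = a (oper (Fr X) \<Gamma> \<sigma> (compose (Field \<Gamma>) (\<eta> X) f))"
  by (simp add: EM_alg_def oper_mk_alg)

context
  fixes X a assumes EM: "(X, a) \<in> Obj EM"
begin

lemma EM_X: "X \<in> Obj (Pos U)" and EM_a: "a \<in> monotone_maps (poset (Fr X)) X"
  using EM by (simp_all add: Obj_EM)

lemma EM_unit: "x \<in> Field X \<Longrightarrow> a (\<eta> X x) = x"
proof -
  assume x: "x \<in> Field X"
  have "compose (Field X) a (\<eta> X) x = (\<lambda>x\<in>Field X. x) x" using EM by (simp add: Obj_EM)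
  then show ?thesis using x by (simp add: compose_app)
qed

lemma EM_mult:
  assumes w: "w \<in> Field (poset (Fr (poset (Fr X))))"
  shows "a (on_hom F (poset (Fr X)) X a w) = a (\<epsilon> (Fr X) w)"
proof -
  have "compose (Field (poset (Fr (poset (Fr X))))) a (on_hom F (poset (Fr X)) X a) w =
    compose (Field (poset (Fr (poset (Fr X))))) a (\<epsilon> (Fr X)) w" using EM by (simp add: Obj_EM)
  then show ?thesis using w by (simp add: compose_app)
qed

lemma is_algebra_EM_alg: "is_algebra Ctx \<Sigma> (EM_alg X a)"
  unfolding EM_alg_def
proof (rule is_algebra_mk_alg)
  show "Partial_order X" using EM_X by simp
  fix \<Gamma> \<sigma> f assume *: "\<Gamma> \<in> Ctx" "\<sigma> \<in> \<Sigma> \<Gamma>" "f \<in> monotone_maps \<Gamma> X"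
  show "a (oper (Fr X) \<Gamma> \<sigma> (compose (Field \<Gamma>) (\<eta> X) f)) \<in> Field X"
    using algebra_oper[OF Obj_algebra[OF Fr_Obj[OF EM_X]] *(1,2)
        compose_monotone_maps[OF *(3) \<eta>_monotone[OF EM_X]]]
    by (rule monotone_maps_app[OF EM_a])
qed

text \<open>
  The defining formula of the operations says that \<open>a\<close> commutes with operations on
  generators. For arbitrary arguments \<open>f\<close>, write \<open>\<sigma>(f) = \<epsilon>(\<sigma>(\<eta> \<circ> f))\<close> with
  \<open>\<sigma>(\<eta> \<circ> f)\<close> in \<open>T (T X)\<close>; as \<open>a \<circ> \<epsilon> = a \<circ> T a\<close> by the associativity law,
  and \<open>T a\<close> is a homomorphism with \<open>T a \<circ> \<eta> = \<eta> \<circ> a\<close>, this reduces to the case of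
  generators.
\<close>

lemma structure_map_homomorphism: "a \<in> homomorphisms Ctx \<Sigma> (Fr X) (EM_alg X a)"
proof (rule homomorphismsI)
  show "a \<in> monotone_maps (poset (Fr X)) (poset (EM_alg X a))" using EM_a by simp
next
  note X = EM_X
  note FX = Fr_Obj[OF X]
  note TX = poset_Obj[OF FX]
  fix \<Gamma> \<sigma> f assume *: "\<Gamma> \<in> Ctx" "\<sigma> \<in> \<Sigma> \<Gamma>" and f: "f \<in> monotone_maps \<Gamma> (poset (Fr X))"
  let ?Ta = "on_hom F (poset (Fr X)) X a"
  let ?\<eta>f = "compose (Field \<Gamma>) (\<eta> (poset (Fr X))) f"
  let ?w = "oper (Fr (poset (Fr X))) \<Gamma> \<sigma> ?\<eta>f"
  have \<eta>f: "?\<eta>f \<in> monotone_maps \<Gamma> (poset (Fr (poset (Fr X))))"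
    using compose_monotone_maps[OF f \<eta>_monotone[OF TX]] .
  have w: "?w \<in> Field (poset (Fr (poset (Fr X))))"
    using algebra_oper[OF Obj_algebra[OF Fr_Obj[OF TX]] * \<eta>f] .
  have "compose (Field \<Gamma>) (\<epsilon> (Fr X)) ?\<eta>f = f"
    using monotone_maps_app[OF f] compose_monotone_maps[OF \<eta>f homomorphisms_monotone[OF \<epsilon>_homomorphism[OF FX]]]
    by (intro monotone_maps_eqI[OF _ f]) (auto simp: compose_app \<epsilon>_\<eta>[OF FX])
  then have "a (oper (Fr X) \<Gamma> \<sigma> f) = a (\<epsilon> (Fr X) ?w)"
    using homomorphisms_oper[OF \<epsilon>_homomorphism[OF FX] * \<eta>f] by simp
  also have "\<dots> = a (?Ta ?w)" using EM_mult[OF w] by simp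
  also have "?Ta ?w = oper (Fr X) \<Gamma> \<sigma> (compose (Field \<Gamma>) ?Ta ?\<eta>f)"
    using homomorphisms_oper[OF F_homomorphism[OF TX X EM_a] * \<eta>f] .
  also have "compose (Field \<Gamma>) ?Ta ?\<eta>f = compose (Field \<Gamma>) (\<eta> X) (compose (Field \<Gamma>) a f)"
    using monotone_maps_app[OF f] by (auto simp: compose_def F_\<eta>[OF TX X EM_a])
  also have "a (oper (Fr X) \<Gamma> \<sigma> \<dots>) = oper (EM_alg X a) \<Gamma> \<sigma> (compose (Field \<Gamma>) a f)"
    using oper_EM_alg[OF * compose_monotone_maps[OF f EM_a]] by simp
  finally show "a (oper (Fr X) \<Gamma> \<sigma> f) = oper (EM_alg X a) \<Gamma> \<sigma> (compose (Field \<Gamma>) a f)" .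
qed

text \<open>
  The unit \<open>\<eta>\<close> is a monotone section of the homomorphism \<open>a\<close>, so the inequations pass
  from the free algebra to its quotient.
\<close>

lemma EM_alg_Obj: "EM_alg X a \<in> Obj \<V>"
proof -
  have "satisfies (EM_alg X a) e" if "e \<in> E" for e
  proof (rule satisfies_split_quotient[OF Obj_algebra[OF Fr_Obj[OF EM_X]] structure_map_homomorphism])
    show "\<eta> X \<in> monotone_maps (poset (EM_alg X a)) (poset (Fr X))" using \<eta>_monotone[OF EM_X] by simp
    show "e \<in> inequations Ctx \<Sigma>" using that E by blast
    show "satisfies (Fr X) e" using that Fr_Obj[OF EM_X] by (simp add: Obj_Variety)
  qed (simp add: EM_unit)
  then show ?thesis using is_algebra_EM_alg EM_X by (simp add: Obj_Variety)
qed

lemma \<epsilon>_EM_alg: "\<epsilon> (EM_alg X a) = a"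
  using \<epsilon>_homomorphism[OF EM_alg_Obj] \<epsilon>_\<eta>[OF EM_alg_Obj]
  by (intro free_homomorphisms_eqI[OF EM_X EM_alg_Obj _ structure_map_homomorphism])
    (simp_all add: EM_unit)

end

text \<open>
  The counit is a homomorphism, so it takes operations on generators \<open>\<eta> \<circ> f\<close> to operations
  on \<open>\<epsilon> \<circ> \<eta> \<circ> f = f\<close>.
\<close>

lemma EM_alg_\<epsilon>:
  assumes A: "A \<in> Obj \<V>"
  shows "EM_alg (poset A) (\<epsilon> A) = A"
  unfolding EM_alg_def
proof (rule mk_alg_eqI[OF Obj_algebra[OF A]])
  fix \<Gamma> \<sigma> f assume *: "\<Gamma> \<in> Ctx" "\<sigma> \<in> \<Sigma> \<Gamma>" and f: "f \<in> monotone_maps \<Gamma> (poset A)"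
  note \<eta>f = compose_monotone_maps[OF f \<eta>_monotone[OF poset_Obj[OF A]]]
  have "compose (Field \<Gamma>) (\<epsilon> A) (compose (Field \<Gamma>) (\<eta> (poset A)) f) = f"
    using monotone_maps_app[OF f] compose_monotone_maps[OF \<eta>f homomorphisms_monotone[OF \<epsilon>_homomorphism[OF A]]]
    by (intro monotone_maps_eqI[OF _ f]) (auto simp: compose_app \<epsilon>_\<eta>[OF A])
  then show "\<epsilon> A (oper (Fr (poset A)) \<Gamma> \<sigma> (compose (Field \<Gamma>) (\<eta> (poset A)) f)) = oper A \<Gamma> \<sigma> f"
    using homomorphisms_oper[OF \<epsilon>_homomorphism[OF A] * \<eta>f] by simp
qed

text \<open>
  All operations of the induced algebras come from free algebras, and \<open>T h\<close> is a homomorphism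
  of these which acts as \<open>h\<close> on generators.
\<close>

lemma EM_hom_homomorphism:
  assumes X: "(X, a) \<in> Obj EM" and Y: "(Y, b) \<in> Obj EM" and h: "h \<in> Hom EM (X, a) (Y, b)"
  shows "h \<in> homomorphisms Ctx \<Sigma> (EM_alg X a) (EM_alg Y b)"
proof (rule homomorphismsI)
  have hm: "h \<in> monotone_maps X Y" using h by (simp add: Hom_EM)
  then show "h \<in> monotone_maps (poset (EM_alg X a)) (poset (EM_alg Y b))" by simp
  note pX = EM_X[OF X] and pY = EM_X[OF Y]
  fix \<Gamma> \<sigma> f assume *: "\<Gamma> \<in> Ctx" "\<sigma> \<in> \<Sigma> \<Gamma>" and "f \<in> monotone_maps \<Gamma> (poset (EM_alg X a))"
  then have f: "f \<in> monotone_maps \<Gamma> X" by simp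
  let ?\<eta>f = "compose (Field \<Gamma>) (\<eta> X) f"
  let ?u = "oper (Fr X) \<Gamma> \<sigma> ?\<eta>f"
  have \<eta>f: "?\<eta>f \<in> monotone_maps \<Gamma> (poset (Fr X))"
    using compose_monotone_maps[OF f \<eta>_monotone[OF pX]] .
  have u: "?u \<in> Field (poset (Fr X))" using algebra_oper[OF Obj_algebra[OF Fr_Obj[OF pX]] * \<eta>f] .
  have "h (oper (EM_alg X a) \<Gamma> \<sigma> f) = compose (Field (poset (Fr X))) h a ?u"
    using u by (simp add: oper_EM_alg[OF * f] compose_app)
  also have "\<dots> = b (on_hom F X Y h ?u)"
    using h u by (simp add: Hom_EM compose_app)
  also have "on_hom F X Y h ?u = oper (Fr Y) \<Gamma> \<sigma> (compose (Field \<Gamma>) (on_hom F X Y h) ?\<eta>f)"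
    using homomorphisms_oper[OF F_homomorphism[OF pX pY hm] * \<eta>f] .
  also have "compose (Field \<Gamma>) (on_hom F X Y h) ?\<eta>f = compose (Field \<Gamma>) (\<eta> Y) (compose (Field \<Gamma>) h f)"
    using monotone_maps_app[OF f] by (auto simp: compose_def F_\<eta>[OF pX pY hm])
  also have "b (oper (Fr Y) \<Gamma> \<sigma> \<dots>) = oper (EM_alg Y b) \<Gamma> \<sigma> (compose (Field \<Gamma>) h f)"
    using oper_EM_alg[OF * compose_monotone_maps[OF f hm]] by simp
  finally show "h (oper (EM_alg X a) \<Gamma> \<sigma> f) = oper (EM_alg Y b) \<Gamma> \<sigma> (compose (Field \<Gamma>) h f)" .
qed


section \<open>The comparison functor\<close>

abbreviation "K \<equiv> comparison F forgetful \<epsilon>"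

lemma K_simps [simp]: "on_obj K A = (poset A, \<epsilon> A)" "on_hom K A B h = h"
  by (simp_all add: comparison_def)

lemma K_Obj:
  assumes A: "A \<in> Obj \<V>"
  shows "(poset A, \<epsilon> A) \<in> Obj EM"
proof -
  note FA = Fr_Obj[OF poset_Obj[OF A]]
  have "compose (Field (poset A)) (\<epsilon> A) (\<eta> (poset A)) = (\<lambda>x\<in>Field (poset A). x)"
    by (auto simp: compose_def \<epsilon>_\<eta>[OF A])
  then show ?thesis
    using poset_Obj[OF A] homomorphisms_monotone[OF \<epsilon>_homomorphism[OF A]]
      \<epsilon>_natural[OF FA A \<epsilon>_homomorphism[OF A]]
    by (simp add: Obj_EM)
qed

lemma is_category_EM_Pos: "is_category EM"
  by (intro is_category_EM is_functor_comp[OF is_functor_F is_functor_forgetful])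

lemma is_functor_K: "is_functor \<V> EM K"
  unfolding is_functor_def
proof (intro conjI ballI)
  show "is_category \<V>" "is_category EM" by (rule is_category_Variety is_category_EM_Pos)+
  fix A assume A: "A \<in> Obj \<V>"
  then show "on_obj K A \<in> Obj EM" using K_Obj by simp
  show "on_hom K A A (Id \<V> A) = Id EM (on_obj K A)" by simp
  fix B f assume B: "B \<in> Obj \<V>" and f: "f \<in> Hom \<V> A B"
  then show "on_hom K A B f \<in> Hom EM (on_obj K A) (on_obj K B)"
    using \<epsilon>_natural[OF A B] homomorphisms_monotone by (auto simp: Hom_EM)
  fix D g
  show "on_hom K A D (Comp \<V> A B D g f) =
      Comp EM (on_obj K A) (on_obj K B) (on_obj K D) (on_hom K B D g) (on_hom K A B f)" by simp
qed

definition L :: "('u rel \<times> ('u \<Rightarrow> 'u), 'u \<Rightarrow> 'u, ('v, 's, 'u) alg, 'u \<Rightarrow> 'u) ftor" where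
  "L = \<lparr>on_obj = \<lambda>(X, a). EM_alg X a, on_hom = \<lambda>_ _ h. h\<rparr>"

lemma L_simps [simp]: "on_obj L (X, a) = EM_alg X a" "on_hom L P Q h = h"
  by (simp_all add: L_def)

lemma is_functor_L: "is_functor EM \<V> L"
  unfolding is_functor_def
  by (auto simp: is_category_EM_Pos is_category_Variety EM_alg_Obj EM_hom_homomorphism)

lemma comparison_isomorphism: "is_isomorphism \<V> EM K"
  unfolding is_isomorphism_def
proof (intro conjI exI)
  show "is_functor \<V> EM K" by (rule is_functor_K)
  show "is_functor EM \<V> L" by (rule is_functor_L)
  show "eq_ftor \<V> (comp_ftor L K) id_ftor"
    unfolding eq_ftor_def by (simp add: comp_ftor_def id_ftor_def EM_alg_\<epsilon>)
  show "eq_ftor EM (comp_ftor K L) id_ftor"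
    unfolding eq_ftor_def by (auto simp: comp_ftor_def id_ftor_def \<epsilon>_EM_alg)
qed

end

theorem theorem3p24:
  fixes U :: "'u set set"
    and Ctx :: "'v rel set"
    and \<Sigma> :: "'v rel \<Rightarrow> 's set"
    and E :: "('v, 's) inequation set"
  assumes "universe U"
    and "represents_finite_posets Ctx"
    and "signature U Ctx \<Sigma>"
    and "E \<subseteq> inequations Ctx \<Sigma>"
  shows "monadic (Variety U Ctx \<Sigma> E) (Pos U) forgetful"
proof -
  have "\<forall>X\<in>Obj (Pos U). \<exists>Q \<eta>. is_free_algebra U Ctx \<Sigma> E X Q \<eta>"
    using free_algebra_exists[OF assms] by simp
  then obtain Fr \<eta> where "\<And>X. X \<in> Obj (Pos U) \<Longrightarrow> is_free_algebra U Ctx \<Sigma> E X (Fr X) (\<eta> X)"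
    by metis
  then interpret free_algebras U Ctx \<Sigma> E Fr \<eta>
    using assms(4) by unfold_locales
  show ?thesis
    unfolding monadic_def using free_forgetful_adjunction comparison_isomorphism by blast
qed

end
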